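(* Let $p\equiv1\pmod{12}$ be a prime and $\eta_{12}$ a primitive character of order $12$ of $\mathbb F_p^\times$. Then for every $\lambda\in\mathbb F_p$ with $\lambda\notin\{-1,2,\tfrac12\}$ and $\lambda^2-\lambda+1\neq0$, $${}_2\mathbb P_1\!\left[\begin{matrix}\eta_{12}&\eta_{12}^5\\&\varepsilon\end{matrix};\frac{27\lambda^2(\lambda-1)^2}{4(\lambda^2-\lambda+1)^3};p\right]=\eta_{12}(-1)\,\eta_{12}^3(1-\lambda+\lambda^2)\,{}_2\mathbb P_1\!\left[\begin{matrix}\phi&\phi\\&\varepsilon\end{matrix};\lambda;p\right].$$
   Context: Here $q=p$. Every multiplicative character $\chi$ of $\mathbb F_p^\times$, including the trivial character $\varepsilon$, is extended to $\mathbb F_p$ by $\chi(0)=0$; $\phi$ is the quadratic character, $\overline\chi$ the complex-conjugate (inverse) character, and products/powers of characters are pointwise. Period function: ${}_2\mathbb P_1\!\left[\begin{matrix}A&B\\&C\end{matrix};\lambda;p\right]=\sum_{y\in\mathbb F_p}B(y)\,\overline BC(1-y)\,\overline A(1-\lambda y)$. *)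

theory Defs
  imports "HOL-Analysis.Analysis" "Berlekamp_Zassenhaus.Finite_Field"
begin

definition mult_char :: "('a::field \<Rightarrow> complex) \<Rightarrow> bool" where
  "mult_char c \<longleftrightarrow> c 0 = 0 \<and> c 1 = 1 \<and> (\<forall>x y. c (x * y) = c x * c y)"

definition triv_char :: "'a::field \<Rightarrow> complex" where
  "triv_char x = (if x = 0 then 0 else 1)"

definition quad_char :: "'a::field \<Rightarrow> complex" where
  "quad_char x = (if x = 0 then 0 else if (\<exists>y. y * y = x) then 1 else -1)"

definition char_pow :: "('a \<Rightarrow> complex) \<Rightarrow> nat \<Rightarrow> 'a \<Rightarrow> complex" where
  "char_pow c n x = c x ^ n"

definition char_conj :: "('a \<Rightarrow> complex) \<Rightarrow> 'a \<Rightarrow> complex" where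
  "char_conj c x = cnj (c x)"

definition primitive_char_of_order :: "nat \<Rightarrow> ('a::field \<Rightarrow> complex) \<Rightarrow> bool" where
  "primitive_char_of_order n c \<longleftrightarrow> mult_char c \<and> char_pow c n = triv_char \<and>
     (\<forall>k. 0 < k \<and> k < n \<longrightarrow> char_pow c k \<noteq> triv_char)"

definition period21 ::
  "('a::{finite,field} \<Rightarrow> complex) \<Rightarrow> ('a \<Rightarrow> complex) \<Rightarrow> ('a \<Rightarrow> complex) \<Rightarrow> 'a \<Rightarrow> complex" where
  "period21 A B C lam = (\<Sum>y\<in>UNIV. B y * (char_conj B (1 - y) * C (1 - y)) * char_conj A (1 - lam * y))"

end

theory Submission
  imports Defs
begin

text \<open>
Write \<open>\<phi> = \<eta>\<^sup>6\<close> and \<open>\<omega> = \<eta>\<^sup>4\<close>. Up to a quadratic twist the right-hand side is the point count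
\<open>\<Sum>\<^sub>u \<phi> (c u\<^sup>3 + u + 1)\<close> of an elliptic curve. A kernel form of the triplication formula for
Gauss sums evaluates \<open>F (n, s) = \<Sum> \<omega> (y / z)\<close>, summed over \<open>x y z = n\<close> and \<open>x + y + z = s\<close>:
it equals \<open>q [s\<^sup>3 = 27 n] - (1 + \<omega> n + \<omega>\<^sup>2 n)\<close>. Inserting this replaces the cubic by a quadratic and
turns the point count into \<open>\<Sum>\<^sub>r \<eta>\<^sup>2 (1 + r) \<phi> (r\<^sup>2 + K)\<close>, which a quadratic transformation
identifies with the left-hand side.

The kernel formula has an extremal proof. Put \<open>G = F + 1 + \<omega> + \<omega>\<^sup>2\<close>. The second moment of \<open>G\<close> over all
\<open>(n, s)\<close> is exactly \<open>q\<^sup>3\<close>. At each of the \<open>q\<close> points \<open>(u\<^sup>3, 3 u)\<close> the curve is a nodal cubic on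
which \<open>y / z\<close> is a cube, so \<open>G \<ge> q\<close> there. This exhausts the second moment, hence \<open>G\<close> vanishes elsewhere.
\<close>

subsection \<open>Multiplicative characters\<close>

lemma mult_char_0: "mult_char c \<Longrightarrow> c 0 = 0"
  and mult_char_1: "mult_char c \<Longrightarrow> c 1 = 1"
  and mult_char_mult: "mult_char c \<Longrightarrow> c (x * y) = c x * c y"
  by (auto simp: mult_char_def)

lemma mult_char_eq_0_iff: "mult_char c \<Longrightarrow> c x = 0 \<longleftrightarrow> x = 0"
  by (metis mult_char_def mult_zero_left right_inverse zero_neq_one)

lemma mult_char_inverse:
  assumes "mult_char c" shows "c (inverse x) = inverse (c x)"
proof (cases "x = 0")
  case False
  then have "c (inverse x) * c x = 1"
    using assms by (metis left_inverse mult_char_1 mult_char_mult)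
  then show ?thesis
    by (metis inverse_unique mult.commute)
qed (simp add: mult_char_0[OF assms])

lemma mult_char_divide: "mult_char c \<Longrightarrow> c (x / y) = c x / c y"
  by (simp add: divide_inverse mult_char_mult mult_char_inverse)

lemma mult_char_power: "mult_char c \<Longrightarrow> c (x ^ n) = c x ^ n"
  by (induction n) (simp_all add: mult_char_1 mult_char_mult)

lemmas mult_char_simps =
  mult_char_0 mult_char_1 mult_char_mult mult_char_inverse mult_char_divide mult_char_power

lemma mult_char_char_pow: "mult_char c \<Longrightarrow> n > 0 \<Longrightarrow> mult_char (char_pow c n)"
  by (auto simp: mult_char_def char_pow_def power_mult_distrib)

lemma mult_char_prod: "mult_char a \<Longrightarrow> mult_char b \<Longrightarrow> mult_char (\<lambda>x. a x * b x)"
  by (auto simp: mult_char_def)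

lemma mult_char_minus_square: "mult_char c \<Longrightarrow> c (- 1) ^ 2 = 1"
  by (metis mult_char_1 mult_char_power power2_minus one_power2)

section \<open>Reindexing and orthogonality for sums over a finite field\<close>

lemma sum_affine:
  fixes f :: "'a::{finite,field} \<Rightarrow> 'b::comm_monoid_add"
  assumes "a \<noteq> 0"
  shows "(\<Sum>x\<in>UNIV. f (a * x + b)) = (\<Sum>x\<in>UNIV. f x)"
  by (rule sum.reindex_bij_witness[where i="\<lambda>x. (x - b) / a" and j="\<lambda>x. a * x + b"])
    (use assms in \<open>auto simp: field_simps\<close>)

lemma sum_scale:
  fixes f :: "'a::{finite,field} \<Rightarrow> 'b::comm_monoid_add"
  assumes "a \<noteq> 0"
  shows "(\<Sum>x\<in>UNIV. f (a * x)) = (\<Sum>x\<in>UNIV. f x)"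
  using sum_affine[OF assms, of f 0] by simp

lemma sum_divide_left:
  fixes f :: "'a::{finite,field} \<Rightarrow> 'b::comm_monoid_add"
  assumes "a \<noteq> 0"
  shows "(\<Sum>x\<in>UNIV. f (a / x)) = (\<Sum>x\<in>UNIV. f x)"
  by (rule sum.reindex_bij_witness[where i="\<lambda>x. a / x" and j="\<lambda>x. a / x"])
    (use assms in auto)

lemma sum_fibres:
  fixes f :: "'i::finite \<Rightarrow> 'b::comm_monoid_add" and h :: "'i \<Rightarrow> 'j::finite"
  shows "(\<Sum>i\<in>UNIV. f i) = (\<Sum>j\<in>UNIV. \<Sum>i | h i = j. f i)"
  using sum.group[of "UNIV::'i set" "UNIV::'j set" h f] by simp

lemma sum_mult_char_eq_0:
  fixes c :: "'a::{finite,field} \<Rightarrow> complex"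
  assumes "mult_char c" "c \<noteq> triv_char"
  shows "(\<Sum>x\<in>UNIV. c x) = 0"
proof -
  obtain a where a: "c a \<noteq> triv_char a" using assms(2) by auto
  then have a0: "a \<noteq> 0" and "c a \<noteq> 1"
    using mult_char_0[OF assms(1)] by (auto simp: triv_char_def split: if_splits)
  have "(\<Sum>x\<in>UNIV. c x) = (\<Sum>x\<in>UNIV. c (a * x))" by (simp add: sum_scale[OF a0])
  also have "\<dots> = c a * (\<Sum>x\<in>UNIV. c x)"
    by (simp add: mult_char_mult[OF assms(1)] sum_distrib_left)
  finally show ?thesis using \<open>c a \<noteq> 1\<close> by simp
qed

lemma sum_triv_char:
  "(\<Sum>x\<in>UNIV. triv_char (x::'a::{finite,field})) = of_nat CARD('a) - 1"
proof -
  have "(\<Sum>x\<in>UNIV. triv_char (x::'a)) = (\<Sum>x\<in>UNIV. 1 - (if x = (0::'a) then 1 else 0))"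
    by (rule sum.cong) (auto simp: triv_char_def)
  then show ?thesis by (simp add: sum_subtractf)
qed

subsection \<open>Jacobi sums\<close>

definition jacobi_sum :: "('a::{finite,field} \<Rightarrow> complex) \<Rightarrow> ('a \<Rightarrow> complex) \<Rightarrow> complex" where
  "jacobi_sum A B = (\<Sum>x\<in>UNIV. A x * B (1 - x))"

text \<open>Scaling \<open>x\<close> by \<open>b / a\<close> takes \<open>b\<close> out of both
  arguments and leaves a Jacobi sum. At \<open>b = 0\<close> the left side is a multiple of the full
  sum of the nontrivial product character, hence 0 like the right side.\<close>

lemma sum_mult_char_linear:
  fixes A B :: "'a::{finite,field} \<Rightarrow> complex"
  assumes "mult_char A" "mult_char B" "(\<lambda>x. A x * B x) \<noteq> triv_char" "a \<noteq> 0"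
  shows "(\<Sum>x\<in>UNIV. A x * B (b - a * x)) = A b * B b / A a * jacobi_sum A B"
proof (cases "b = 0")
  case True
  have "(\<Sum>x\<in>UNIV. A x * B (b - a * x)) = (\<Sum>x\<in>UNIV. B (- a) * (A x * B x))"
    by (rule sum.cong) (simp_all add: True flip: mult_char_mult[OF assms(2)])
  also have "\<dots> = 0"
    using sum_mult_char_eq_0[OF mult_char_prod[OF assms(1,2)] assms(3)]
    by (simp flip: sum_distrib_left)
  finally show ?thesis by (simp add: True mult_char_0[OF assms(1)])
next
  case False
  have "(\<Sum>x\<in>UNIV. A x * B (b - a * x)) = (\<Sum>x\<in>UNIV. A (b / a * x) * B (b - a * (b / a * x)))"
    using sum_scale[of "b / a" "\<lambda>x. A x * B (b - a * x)"] False assms(4) by simp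
  also have "\<dots> = (\<Sum>x\<in>UNIV. A b * B b / A a * (A x * B (1 - x)))"
  proof (rule sum.cong)
    fix x
    have "b - a * (b / a * x) = b * (1 - x)" using assms(4) by (simp add: field_simps)
    then show "A (b / a * x) * B (b - a * (b / a * x)) = A b * B b / A a * (A x * B (1 - x))"
      by (simp add: mult_char_simps assms(1,2))
  qed simp
  finally show ?thesis by (simp add: jacobi_sum_def sum_distrib_left)
qed

text \<open>For \<open>u \<noteq> v\<close> the Moebius map \<open>(t - u) / (t - v)\<close> carries
  the field without \<open>v\<close> onto the field without \<open>1\<close>, so the sum is the full
  sum of \<open>B\<close>, which is 0, less \<open>B 1\<close>. The term at \<open>t = v\<close> is
  0 by the convention for division by zero.\<close>

lemma sum_mult_char_correlation:
  fixes B :: "'a::{finite,field} \<Rightarrow> complex"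
  assumes "mult_char B" "B \<noteq> triv_char"
  shows "(\<Sum>t\<in>UNIV. B (t - u) / B (t - v)) = (if u = v then of_nat CARD('a) else 0) - 1"
proof (cases "u = v")
  case True
  have "(\<Sum>t\<in>UNIV. B (t - u) / B (t - v)) = (\<Sum>t\<in>UNIV. triv_char (1 * t + (- u)))"
    using mult_char_eq_0_iff[OF assms(1)] True by (intro sum.cong) (auto simp: triv_char_def)
  then show ?thesis using True
    by (simp only: sum_affine[OF one_neq_zero] sum_triv_char) simp
next
  case False
  have "(\<Sum>t\<in>UNIV. B (t - u) / B (t - v)) = (\<Sum>t\<in>UNIV - {v}. B ((t - u) / (t - v)))"
    by (rule sum.mono_neutral_cong_right) (auto simp: mult_char_simps assms(1))
  also have "\<dots> = (\<Sum>t\<in>UNIV - {v}. B (1 + (v - u) / (t - v)))"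
    by (rule sum.cong) (auto simp: field_simps)
  also have "\<dots> = (\<Sum>x\<in>UNIV - {1}. B x)"
    by (rule sum.reindex_bij_witness[where j="\<lambda>t. 1 + (v - u) / (t - v)"
            and i="\<lambda>x. v + (v - u) / (x - 1)"]) (use False in auto)
  also have "\<dots> = - 1"
    using sum_mult_char_eq_0[OF assms] by (simp add: sum_diff mult_char_1[OF assms(1)])
  finally show ?thesis using False by simp
qed

text \<open>If the Jacobi sum vanished, so would the additive convolution of \<open>A\<close> and
  \<open>B\<close> at every \<open>t\<close>. Dividing by \<open>B (t - 1)\<close> and summing over
  \<open>t\<close> inverts the convolution at the point 1 and returns \<open>CARD('a) * A 1\<close>,
  which is not 0.\<close>

lemma jacobi_sum_nonzero:
  fixes A B :: "'a::{finite,field} \<Rightarrow> complex"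
  assumes "mult_char A" "mult_char B" "A \<noteq> triv_char" "B \<noteq> triv_char"
    "(\<lambda>x. A x * B x) \<noteq> triv_char"
  shows "jacobi_sum A B \<noteq> 0"
proof
  assume J: "jacobi_sum A B = 0"
  have "0 = (\<Sum>t\<in>UNIV. (\<Sum>u\<in>UNIV. A u * B (t - 1 * u)) / B (t - 1))"
    by (simp only: sum_mult_char_linear[OF assms(1,2,5) one_neq_zero]) (simp add: J)
  also have "\<dots> = (\<Sum>t\<in>UNIV. \<Sum>u\<in>UNIV. A u * (B (t - u) / B (t - 1)))"
    by (simp add: sum_divide_distrib)
  also have "\<dots> = (\<Sum>u\<in>UNIV. A u * (\<Sum>t\<in>UNIV. B (t - u) / B (t - 1)))"
    by (subst sum.swap) (simp add: sum_distrib_left)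
  also have "\<dots> = (\<Sum>u\<in>UNIV. (if u = 1 then of_nat CARD('a) * A u else 0) - A u)"
    by (rule sum.cong) (auto simp: sum_mult_char_correlation[OF assms(2,4)] algebra_simps)
  also have "\<dots> = of_nat CARD('a)"
    by (simp add: sum_subtractf sum_mult_char_eq_0[OF assms(1,3)] mult_char_1[OF assms(1)])
  finally show False by simp
qed

subsection \<open>The quadratic character\<close>

text \<open>Multiplication by an element with value -1 injects the set \<open>A\<close> of value 1
  into the set \<open>B\<close> of value -1, so \<open>A\<close> holds at most half of the nonzero
  elements. The nonzero squares \<open>Q\<close> lie in \<open>A\<close> and make up at least half,
  since each has at most two roots; hence \<open>Q = A\<close>.\<close>

lemma quadratic_char_unique:
  fixes c :: "'a::{finite,field} \<Rightarrow> complex"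
  assumes c: "mult_char c" "char_pow c 2 = triv_char" "c \<noteq> triv_char"
  shows "c = quad_char"
proof -
  have pm: "c x = 1 \<or> c x = - 1" if "x \<noteq> 0" for x
    using fun_cong[OF c(2), of x] that by (simp add: char_pow_def triv_char_def power2_eq_1_iff)
  obtain a where a0: "a \<noteq> 0" and a: "c a = - 1"
    using c(3) pm mult_char_0[OF c(1)] unfolding fun_eq_iff triv_char_def by metis
  define A B Q where "A = {x. c x = 1}" and "B = {x. c x = - 1}"
    and "Q = (\<lambda>x. x * x) ` (UNIV - {0::'a})"
  have AB: "A \<union> B = UNIV - {0}" "A \<inter> B = {}"
    using pm mult_char_0[OF c(1)] by (auto simp: A_def B_def)
  have "card A \<le> card B"
    by (rule card_inj_on_le[where f="\<lambda>x. a * x"])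
      (auto simp: A_def B_def inj_on_def a0 a mult_char_mult[OF c(1)])
  moreover have "card A + card B = card (UNIV - {0::'a})"
    using card_Un_disjoint[of A B] AB by simp
  moreover have "card (UNIV - {0::'a}) \<le> 2 * card Q"
  proof -
    have "UNIV - {0::'a} = (\<Union>s\<in>Q. {x. x * x = s})"
      by (auto simp: Q_def)
    then have "card (UNIV - {0::'a}) \<le> (\<Sum>s\<in>Q. card {x. x * x = s})"
      using card_UN_le[of Q "\<lambda>s. {x. x * x = s}"] by simp
    also have "\<dots> \<le> (\<Sum>s\<in>Q. 2)"
    proof (rule sum_mono)
      fix s assume "s \<in> Q"
      then obtain r where "s = r * r" by (auto simp: Q_def)
      then have "{x. x * x = s} \<subseteq> {r, - r}" by (auto simp: square_eq_iff)
      then have "card {x. x * x = s} \<le> card {r, - r}" by (intro card_mono) auto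
      also have "\<dots> \<le> 2" by (simp add: card_insert_if)
      finally show "card {x. x * x = s} \<le> 2" .
    qed
    finally show ?thesis by simp
  qed
  moreover have "Q \<subseteq> A"
    using pm by (fastforce simp: Q_def A_def mult_char_mult[OF c(1)])
  ultimately have "Q = A"
    by (intro card_seteq) auto
  then have sq: "c x = 1 \<longleftrightarrow> (\<exists>y. y * y = x)" if "x \<noteq> 0" for x
  proof -
    have "c x = 1 \<longleftrightarrow> x \<in> Q" using \<open>Q = A\<close> by (simp add: A_def)
    then show ?thesis using that by (auto simp: Q_def)
  qed
  show ?thesis
    using sq pm mult_char_0[OF c(1)] by (auto simp: quad_char_def fun_eq_iff)
qed

section \<open>Sums with the quadratic character, up to the quadratic transformation\<close>

lemma quad_char_cases: "quad_char x = 0 \<or> quad_char x = 1 \<or> quad_char x = - 1"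
  by (simp add: quad_char_def)

lemma quad_char_square: "r \<noteq> 0 \<Longrightarrow> quad_char (r * r) = 1"
  by (auto simp: quad_char_def)

lemma quad_char_eqI:
  assumes "mult_char (quad_char :: 'a::field \<Rightarrow> complex)" "x * y = r * r" "r \<noteq> (0::'a)"
  shows "quad_char x = quad_char y"
proof -
  have "quad_char x * quad_char y = 1"
    using quad_char_square[OF assms(3)] by (simp add: assms(2) flip: mult_char_mult[OF assms(1)])
  then show ?thesis using quad_char_cases[of x] quad_char_cases[of y] by auto
qed

text \<open>From \<open>v + 1 / v = t\<close> follow \<open>(t + 2) * v = (v + 1) * (v + 1)\<close>
  and \<open>(t - 2) * v = (v - 1) * (v - 1)\<close>, so \<open>t + 2\<close> and
  \<open>t - 2\<close>, where nonzero, lie in the square class of \<open>v\<close> and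
  \<open>1 / v\<close>. Without a solution \<open>v\<close> the discriminant
  \<open>(t + 2) * (t - 2)\<close> is a nonsquare and the two values cancel.\<close>

lemma sum_quad_char_add_inverse:
  fixes t :: "'a::{finite,field}"
  assumes two: "(2::'a) \<noteq> 0" and Q: "mult_char (quad_char :: 'a \<Rightarrow> complex)"
  shows "(\<Sum>v | v \<noteq> 0 \<and> v + 1 / v = t. quad_char v) = quad_char (t + 2) + quad_char (t - 2)"
proof (cases "\<exists>v. v \<noteq> 0 \<and> v + 1 / v = t")
  case False
  have t2: "t \<noteq> 2" using False[unfolded not_ex, rule_format, of 1] by auto
  have tm2: "t \<noteq> - 2" using False[unfolded not_ex, rule_format, of "-1"] by auto
  have "d * d \<noteq> (t + 2) * (t - 2)" for d
  proof
    assume d: "d * d = (t + 2) * (t - 2)"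
    define v where "v = (t + d) / 2"
    have "2 * v = t + d" using two by (simp add: v_def del: distrib_left_numeral)
    then have d': "d = 2 * v - t" by simp
    have "2 * 2 * (v * v + 1 - t * v) = d * d - (t + 2) * (t - 2)"
      unfolding d' by (simp add: algebra_simps)
    then have "2 * 2 * (v * v + 1 - t * v) = 0" using d by simp
    then have v: "v * v + 1 = t * v" using two by (metis eq_iff_diff_eq_0 mult_eq_0_iff)
    then have "v \<noteq> 0" by auto
    moreover from this v have "v + 1 / v = t" by (simp add: field_simps)
    ultimately show False using False by blast
  qed
  then have "quad_char ((t + 2) * (t - 2)) = - 1"
    using t2 tm2 by (auto simp: quad_char_def eq_neg_iff_add_eq_0)
  then have "quad_char (t + 2) + quad_char (t - 2) = 0"
    using quad_char_cases[of "t + 2"] quad_char_cases[of "t - 2"] by (auto simp: mult_char_mult[OF Q])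
  moreover have "{v. v \<noteq> 0 \<and> v + 1 / v = t} = {}" using False by blast
  ultimately show ?thesis by (metis sum.empty)
next
  case True
  then obtain v where v0: "v \<noteq> 0" and v: "v + 1 / v = t" by blast
  have tv: "t * v = v * v + 1" using v v0 by (auto simp: field_simps)
  have E: "{w. w \<noteq> 0 \<and> w + 1 / w = t} = {v, 1 / v}"
  proof (intro equalityI subsetI)
    fix w assume "w \<in> {w. w \<noteq> 0 \<and> w + 1 / w = t}"
    then have w0: "w \<noteq> 0" and "t * w = w * w + 1" by (auto simp: field_simps)
    then have "(w - v) * (w * v - 1) = 0" using tv by Groebner_Basis.algebra
    then have "w = v \<or> w * v = 1" by simp
    then show "w \<in> {v, 1 / v}" using v0 by (auto simp: field_simps)
  qed (use v v0 in \<open>auto simp: add.commute\<close>)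
  show ?thesis
  \<comment> \<open>At these values \<open>v = 1 / v\<close> is a double root and one of
    \<open>t + 2\<close>, \<open>t - 2\<close> is 0, so both sides consist of a single term.\<close>
  proof (cases "v = 1 \<or> v = - 1")
    case True
    have "quad_char (2 * 2 :: 'a) = 1" "quad_char (- 2 - 2 :: 'a) = quad_char (- 1 :: 'a)"
      using quad_char_square[OF two] quad_char_eqI[OF Q, of "-2-2" "-1" 2] two by simp_all
    then show ?thesis
      unfolding E using True v mult_char_0[OF Q] mult_char_1[OF Q] by auto
  next
    case False
    then have "v * v \<noteq> 1" by (simp add: square_eq_1_iff)
    then have d: "v \<noteq> 1 / v" using v0 by (auto simp: field_simps)
    have "(t + 2) * v = (v + 1) * (v + 1)" "(t - 2) * v = (v - 1) * (v - 1)"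
      using tv by Groebner_Basis.algebra+
    moreover have "v + 1 \<noteq> 0" "v - 1 \<noteq> 0" using False by (auto simp: eq_neg_iff_add_eq_0)
    ultimately have "quad_char (t + 2) = quad_char v" "quad_char (t - 2) = quad_char v"
      using quad_char_eqI[OF Q] by blast+
    moreover have "quad_char (1 / v) = quad_char v"
      using quad_char_eqI[OF Q, of "1 / v" v 1] v0 by simp
    ultimately show ?thesis unfolding E using d by simp
  qed
qed

text \<open>Inverting \<open>y\<close> makes the argument of \<open>m\<close> equal to
  \<open>y + s / y - (1 + s)\<close>. For a nonsquare \<open>s\<close> the involution
  \<open>s / y\<close> keeps this and negates \<open>quad_char y\<close>, so the sum is 0. For
  \<open>s = r * r\<close> with \<open>r \<noteq> 0\<close>, put \<open>y = r * v\<close> and group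
  by \<open>t = v + 1 / v\<close>: the preceding fibre sum leaves two linear sums, one for each
  square root of \<open>s\<close>.\<close>

lemma sum_quad_char_twisted_quadratic:
  fixes s :: "'a::{finite,field}" and m :: "'a \<Rightarrow> complex"
  assumes two: "(2::'a) \<noteq> 0" and Q: "mult_char (quad_char :: 'a \<Rightarrow> complex)"
    and m: "mult_char m" and nt: "(\<lambda>x. quad_char x * m x) \<noteq> triv_char"
  shows "(\<Sum>y\<in>UNIV. quad_char y * m ((1 - y) * (1 - s * y) / y))
    = m (- 1) * jacobi_sum quad_char m * (\<Sum>r | r * r = s. m (1 + r) ^ 2)"
proof -
  let ?J = "jacobi_sum quad_char m"
  have "(\<Sum>y\<in>UNIV. quad_char y * m ((1 - y) * (1 - s * y) / y))
     = (\<Sum>y\<in>UNIV. quad_char (1 / y) * m ((1 - 1 / y) * (1 - s * (1 / y)) / (1 / y)))"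
    by (rule sum_divide_left[symmetric]) simp
  also have "\<dots> = (\<Sum>y\<in>UNIV. quad_char y * m (y + s / y - (1 + s)))"
  proof (rule sum.cong)
    fix y :: 'a
    show "quad_char (1 / y) * m ((1 - 1 / y) * (1 - s * (1 / y)) / (1 / y))
        = quad_char y * m (y + s / y - (1 + s))"
    proof (cases "y = 0")
      case False
      then have "(1 - 1 / y) * (1 - s * (1 / y)) / (1 / y) = y + s / y - (1 + s)"
        by (simp add: field_simps)
      moreover have "quad_char (1 / y) = quad_char y"
        using quad_char_eqI[OF Q, of "1 / y" y 1] False by simp
      ultimately show ?thesis by simp
    qed (simp add: mult_char_0[OF Q])
  qed simp
  also have "\<dots> = m (- 1) * ?J * (\<Sum>r | r * r = s. m (1 + r) ^ 2)"
  proof (cases "\<exists>r. r * r = s")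
    case False
    then have s0: "s \<noteq> 0" by auto
    have qs: "quad_char s = - 1" using False s0 by (auto simp: quad_char_def)
    let ?f = "\<lambda>y. quad_char y * m (y + s / y - (1 + s))"
    have "sum ?f UNIV = (\<Sum>y\<in>UNIV. ?f (s / y))" by (rule sum_divide_left[OF s0, symmetric])
    also have "\<dots> = (\<Sum>y\<in>UNIV. - ?f y)"
    proof (rule sum.cong)
      fix y :: 'a
      show "?f (s / y) = - ?f y"
      proof (cases "y = 0")
        case False
        then show ?thesis
          using quad_char_cases[of y] mult_char_eq_0_iff[OF Q, of y] s0 qs
          by (auto simp: mult_char_divide[OF Q] add.commute)
      qed (simp add: mult_char_0[OF Q])
    qed simp
    finally have "sum ?f UNIV = 0" by (simp add: sum_negf)
    moreover have "{r. r * r = s} = {}" using False by blast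
    ultimately show ?thesis by (metis mult_zero_right sum.empty)
  next
    case True
    then obtain r where r: "s = r * r" by blast
    \<comment> \<open>Both linear sums at once: \<open>e = 2\<close> belongs to
      \<open>r' = r\<close>, and \<open>e = - 2\<close> to \<open>r' = - r\<close>. Shifting by
      \<open>e\<close> turns the constant into the negative of a square, so only
      \<open>quad_char (- 1)\<close> survives from it, and that cancels against
      \<open>quad_char (- r)\<close>.\<close>
    have lin: "(\<Sum>x\<in>UNIV. quad_char (x + e) * m (r * x - (1 + s)))
        = quad_char r * (m (- 1) * ?J * m (1 + r') ^ 2)"
      if "r \<noteq> 0" "r * e + (1 + s) = (1 + r') * (1 + r')" for e r'
    proof -
      have "(\<Sum>x\<in>UNIV. quad_char (x + e) * m (r * x - (1 + s)))
          = (\<Sum>x\<in>UNIV. quad_char (1 * x + e) * m (- ((1 + r') * (1 + r')) - (- r) * (1 * x + e)))"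
        by (simp only: that(2)[symmetric]) (simp add: algebra_simps)
      also have "\<dots> = (\<Sum>x\<in>UNIV. quad_char x * m (- ((1 + r') * (1 + r')) - (- r) * x))"
        by (rule sum_affine) simp
      also have "\<dots> = quad_char (- ((1 + r') * (1 + r'))) * m (- ((1 + r') * (1 + r'))) / quad_char (- r) * ?J"
        by (rule sum_mult_char_linear[OF Q m nt]) (use that in simp)
      also have "quad_char (- ((1 + r') * (1 + r'))) * m (- ((1 + r') * (1 + r'))) / quad_char (- r)
          = quad_char r * (m (- 1) * m (1 + r') ^ 2)"
      proof (cases "1 + r' = 0")
        case True then show ?thesis by (simp add: mult_char_0 Q m)
      next
        case False
        have "m (- ((1 + r') * (1 + r'))) = m (- 1) * m (1 + r') ^ 2"
          by (metis m mult_char_mult mult_minus1 power2_eq_square)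
        moreover have "quad_char (- ((1 + r') * (1 + r'))) = quad_char (- 1 :: 'a)"
          using quad_char_eqI[OF Q, of "- ((1 + r') * (1 + r'))" "-1" "1 + r'"] False by simp
        moreover have "quad_char (- r) = quad_char (- 1 :: 'a) * quad_char r"
          by (metis Q mult_char_mult mult_minus1)
        moreover have "quad_char r = 1 \<or> quad_char r = - 1"
          "quad_char (- 1 :: 'a) = 1 \<or> quad_char (- 1 :: 'a) = - 1"
          using that by (auto simp: quad_char_def)
        ultimately show ?thesis by auto
      qed
      finally show ?thesis by (simp add: mult_ac)
    qed
    show ?thesis
    proof (cases "r = 0")
      case True
      have "(\<Sum>y\<in>UNIV. quad_char y * m (y + s / y - (1 + s))) = (\<Sum>y\<in>UNIV. m (- 1) * (quad_char y * m (1 - y)))"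
        by (rule sum.cong) (simp_all add: r True flip: mult_char_mult[OF m])
      moreover have "{u. u * u = s} = {0}" by (auto simp: r True)
      ultimately show ?thesis
        by (simp add: mult_char_1[OF m] jacobi_sum_def flip: sum_distrib_left)
    next
      case False
      have qr: "quad_char r * quad_char r = 1" using False by (simp add: quad_char_def)
      have "(\<Sum>y\<in>UNIV. quad_char y * m (y + s / y - (1 + s)))
          = (\<Sum>v\<in>UNIV. quad_char (r * v) * m (r * v + s / (r * v) - (1 + s)))"
        by (rule sum_scale[OF False, symmetric])
      also have "\<dots> = (\<Sum>v\<in>UNIV. quad_char r * (quad_char v * m (r * (v + 1 / v) - (1 + s))))"
        using False by (intro sum.cong) (auto simp: mult_char_mult[OF Q] r distrib_left)
      also have "\<dots> = quad_char r * (\<Sum>v\<in>UNIV. quad_char v * m (r * (v + 1 / v) - (1 + s)))"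
        by (simp add: sum_distrib_left)
      also have "(\<Sum>v\<in>UNIV. quad_char v * m (r * (v + 1 / v) - (1 + s)))
          = (\<Sum>t\<in>UNIV. \<Sum>v | v + 1 / v = t. quad_char v * m (r * (v + 1 / v) - (1 + s)))"
        by (rule sum_fibres)
      also have "\<dots> = (\<Sum>t\<in>UNIV. (\<Sum>v | v \<noteq> 0 \<and> v + 1 / v = t. quad_char v) * m (r * t - (1 + s)))"
      proof (rule sum.cong)
        fix t :: 'a
        have "(\<Sum>v | v + 1 / v = t. quad_char v * m (r * (v + 1 / v) - (1 + s)))
            = (\<Sum>v | v \<noteq> 0 \<and> v + 1 / v = t. quad_char v * m (r * t - (1 + s)))"
          by (rule sum.mono_neutral_cong_right) (auto simp: mult_char_0[OF Q])
        then show "(\<Sum>v | v + 1 / v = t. quad_char v * m (r * (v + 1 / v) - (1 + s)))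
            = (\<Sum>v | v \<noteq> 0 \<and> v + 1 / v = t. quad_char v) * m (r * t - (1 + s))"
          by (simp add: sum_distrib_right)
      qed simp
      also have "\<dots> = (\<Sum>t\<in>UNIV. quad_char (t + 2) * m (r * t - (1 + s)))
          + (\<Sum>t\<in>UNIV. quad_char (t + (- 2)) * m (r * t - (1 + s)))"
        by (simp add: sum_quad_char_add_inverse[OF two Q] distrib_right sum.distrib)
      also have "\<dots> = quad_char r * (m (- 1) * ?J * m (1 + r) ^ 2)
          + quad_char r * (m (- 1) * ?J * m (1 + (- r)) ^ 2)"
        using lin[of 2 r] lin[of "- 2" "- r"] False by (simp add: r algebra_simps)
      also have "quad_char r * \<dots> = quad_char r * quad_char r *
           (m (- 1) * ?J * (m (1 + r) ^ 2 + m (1 + (- r)) ^ 2))"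
        by (simp add: algebra_simps)
      also have "\<dots> = m (- 1) * ?J * (m (1 + r) ^ 2 + m (1 + (- r)) ^ 2)"
        by (simp only: qr mult_1)
      also have "m (1 + r) ^ 2 + m (1 + (- r)) ^ 2 = (\<Sum>r | r * r = s. m (1 + r) ^ 2)"
      proof -
        have "r \<noteq> - r" using two False by (metis add_eq_0_iff mult_2 mult_eq_0_iff)
        moreover have "{u. u * u = s} = {r, - r}" by (auto simp: r square_eq_iff)
        ultimately show ?thesis by simp
      qed
      finally show ?thesis .
    qed
  qed
  finally show ?thesis .
qed

text \<open>After grouping by \<open>s = r * r\<close>, a factor \<open>m (- 1) * ?J\<close> allows
  the fibre sum to be replaced by the preceding sum over \<open>y\<close>. Exchanging the summations
  leaves a linear sum over \<open>s\<close>, which yields \<open>?J\<close> once more; being nonzero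
  it cancels, and \<open>m (- 1)\<close> is its own inverse.\<close>

lemma quadratic_transformation:
  fixes K :: "'a::{finite,field}" and m :: "'a \<Rightarrow> complex"
  assumes two: "(2::'a) \<noteq> 0" and Q: "mult_char (quad_char :: 'a \<Rightarrow> complex)"
    and m: "mult_char m" "m \<noteq> triv_char"
    and nq: "(quad_char :: 'a \<Rightarrow> complex) \<noteq> triv_char"
    and nt: "(\<lambda>x. quad_char x * m x) \<noteq> triv_char"
  shows "(\<Sum>r\<in>UNIV. m (1 + r) ^ 2 * quad_char (r * r + K))
    = m (- 1) * (\<Sum>y\<in>UNIV. m ((1 - y) / y) * (quad_char (1 + K * y) * m (1 + K * y)))"
proof -
  let ?J = "jacobi_sum quad_char m"
  let ?R = "\<Sum>y\<in>UNIV. m ((1 - y) / y) * (quad_char (1 + K * y) * m (1 + K * y))"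
  have J0: "?J \<noteq> 0" by (rule jacobi_sum_nonzero[OF Q m(1) nq m(2) nt])
  have "(\<Sum>r\<in>UNIV. m (1 + r) ^ 2 * quad_char (r * r + K))
      = (\<Sum>s\<in>UNIV. \<Sum>r | r * r = s. m (1 + r) ^ 2 * quad_char (r * r + K))"
    by (rule sum_fibres)
  also have "\<dots> = (\<Sum>s\<in>UNIV. quad_char (s + K) * (\<Sum>r | r * r = s. m (1 + r) ^ 2))"
    by (rule sum.cong) (auto simp: sum_distrib_left mult.commute intro!: sum.cong)
  finally have "m (- 1) * ?J * (\<Sum>r\<in>UNIV. m (1 + r) ^ 2 * quad_char (r * r + K))
      = (\<Sum>s\<in>UNIV. quad_char (s + K) * (m (- 1) * ?J * (\<Sum>r | r * r = s. m (1 + r) ^ 2)))"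
    by (simp add: sum_distrib_left mult_ac)
  also have "\<dots> = (\<Sum>s\<in>UNIV. quad_char (s + K) * (\<Sum>y\<in>UNIV. quad_char y * m ((1 - y) * (1 - s * y) / y)))"
    by (simp only: sum_quad_char_twisted_quadratic[OF two Q m(1) nt])
  also have "\<dots> = (\<Sum>y\<in>UNIV. \<Sum>s\<in>UNIV. quad_char y * m ((1 - y) / y) * (quad_char (s + K) * m (1 - s * y)))"
    unfolding sum_distrib_left
    by (subst sum.swap) (simp add: mult_char_mult[OF m(1)] mult_char_divide[OF m(1)] mult_ac)
  also have "\<dots> = (\<Sum>y\<in>UNIV. ?J * (m ((1 - y) / y) * (quad_char (1 + K * y) * m (1 + K * y))))"
  proof (rule sum.cong)
    fix y :: 'a
    show "(\<Sum>s\<in>UNIV. quad_char y * m ((1 - y) / y) * (quad_char (s + K) * m (1 - s * y)))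
        = ?J * (m ((1 - y) / y) * (quad_char (1 + K * y) * m (1 + K * y)))"
    proof (cases "y = 0")
      case True then show ?thesis by (simp add: mult_char_0[OF m(1)])
    next
      case False
      have "(\<Sum>s\<in>UNIV. quad_char (s + K) * m (1 - s * y))
          = (\<Sum>s\<in>UNIV. quad_char (1 * s + K) * m (1 + K * y - y * (1 * s + K)))"
        by (simp add: algebra_simps)
      also have "\<dots> = (\<Sum>s\<in>UNIV. quad_char s * m (1 + K * y - y * s))"
        by (rule sum_affine) simp
      also have "\<dots> = quad_char (1 + K * y) * m (1 + K * y) / quad_char y * ?J"
        by (rule sum_mult_char_linear[OF Q m(1) nt False])
      finally show ?thesis using False mult_char_eq_0_iff[OF Q, of y]
        by (simp flip: sum_distrib_left)
    qed
  qed simp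
  also have "\<dots> = ?J * ?R" by (simp add: sum_distrib_left)
  finally have "m (- 1) * (\<Sum>r\<in>UNIV. m (1 + r) ^ 2 * quad_char (r * r + K)) = ?R"
    using J0 by simp
  then show ?thesis
    using mult_char_minus_square[OF m(1)]
    by (metis (no_types, lifting) mult.assoc mult_1 power2_eq_square)
qed

subsection \<open>The cubic kernel\<close>

definition triple_prod_sum :: "'a::field \<times> 'a \<times> 'a \<Rightarrow> 'a \<times> 'a" where
  "triple_prod_sum = (\<lambda>(x, y, z). (x * y * z, x + y + z))"

text \<open>For a cubic character, \<open>w z ^ 2\<close> is \<open>1 / w z\<close> extended by 0,
  so this is the sum \<open>F\<close> of the overview with \<open>k = (n, s)\<close>.\<close>

definition cubic_kernel :: "('a::{finite,field} \<Rightarrow> complex) \<Rightarrow> 'a \<times> 'a \<Rightarrow> complex" where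
  "cubic_kernel w k = (\<Sum>(x, y, z) | triple_prod_sum (x, y, z) = k. w y * w z ^ 2)"

lemma sum_fibres_mult:
  fixes f :: "'i::finite \<Rightarrow> complex" and h :: "'i \<Rightarrow> 'j::finite"
  shows "(\<Sum>j\<in>UNIV. (\<Sum>i | h i = j. f i) * g j) = (\<Sum>i\<in>UNIV. f i * g (h i))"
  unfolding sum_fibres[of "\<lambda>i. f i * g (h i)" h]
  by (rule sum.cong) (auto simp: sum_distrib_right intro!: sum.cong)

lemma sum_UNIV_triple:
  fixes f :: "'a::finite \<times> 'b::finite \<times> 'c::finite \<Rightarrow> 'd::comm_monoid_add"
  shows "(\<Sum>t\<in>UNIV. f t) = (\<Sum>x\<in>UNIV. \<Sum>y\<in>UNIV. \<Sum>z\<in>UNIV. f (x, y, z))"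
  by (simp add: sum.cartesian_product flip: UNIV_Times_UNIV)

lemma sum_zero_affine:
  fixes f :: "'a::{finite,field} \<Rightarrow> complex"
  assumes "(\<Sum>x\<in>UNIV. f x) = 0"
  shows "(\<Sum>x\<in>UNIV. f (a * x + b)) = (if a = 0 then of_nat CARD('a) * f b else 0)"
  using assms by (simp add: sum_affine)

locale cubic_character =
  fixes w :: "'a::{finite,field} \<Rightarrow> complex" and q :: complex
  defines "q \<equiv> of_nat CARD('a)"
  assumes mult_char_w: "mult_char w" and w_cube: "char_pow w 3 = triv_char"
    and w_nontriv: "w \<noteq> triv_char"
begin

lemmas w_simps = mult_char_simps[OF mult_char_w]

lemma w_pow3: "x \<noteq> 0 \<Longrightarrow> w x ^ 3 = 1"
  using fun_cong[OF w_cube, of x] by (simp add: char_pow_def triv_char_def)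

lemma w_mult_square: "w x * w x ^ 2 = triv_char x"
  using fun_cong[OF w_cube, of x] by (simp add: char_pow_def power3_eq_cube power2_eq_square mult.assoc)

lemma w_minus_1: "w (- 1) = 1"
proof -
  have "w (- 1) ^ 2 = 1" "w (- 1) ^ 3 = 1"
    using mult_char_minus_square[OF mult_char_w] w_pow3 by auto
  then show ?thesis by (simp add: power3_eq_cube power2_eq_square)
qed

lemma cnj_w: "cnj (w x) = w x ^ 2"
proof (cases "x = 0")
  case False
  have "norm (w x) ^ 3 = 1 ^ 3" by (simp add: w_pow3[OF False] flip: norm_power)
  then have "norm (w x) = 1" by (rule power_eq_imp_eq_base) simp_all
  then have "w x * cnj (w x) = w x * w x ^ 2"
    using w_mult_square[of x] False by (simp add: complex_norm_square[symmetric] triv_char_def)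
  then show ?thesis using False mult_char_eq_0_iff[OF mult_char_w, of x] by simp
qed (simp add: w_simps)

lemma sum_w: "(\<Sum>x\<in>UNIV. w x) = 0"
  by (rule sum_mult_char_eq_0[OF mult_char_w w_nontriv])

lemma sum_w2: "(\<Sum>x\<in>UNIV. w x ^ 2) = 0"
  using sum_w by (simp add: cnj_w[symmetric] flip: cnj_sum)

lemma w_pow4: "w x ^ 4 = w x"
  using w_pow3[of x] by (cases "x = 0") (simp_all add: w_simps power4_eq_xxxx power3_eq_cube mult.assoc)

text \<open>The number of cube roots of \<open>n\<close> in the field.\<close>

definition cbrts :: "'a \<Rightarrow> complex" where
  "cbrts n = 1 + w n + w n ^ 2"

lemma cnj_cbrts: "cnj (cbrts n) = cbrts n"
  by (simp add: cbrts_def cnj_w w_pow4 flip: power_mult)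

lemma sum_cbrts_square: "(\<Sum>n\<in>UNIV. cbrts n * cbrts n) = 3 * q - 2"
proof -
  have "cbrts n * cbrts n = 1 + 2 * w n + 2 * w n ^ 2 + 2 * triv_char n + w n ^ 2 + w n ^ 4" for n
    unfolding cbrts_def w_mult_square[symmetric] by Groebner_Basis.algebra
  then have "(\<Sum>n\<in>UNIV. cbrts n * cbrts n)
      = (\<Sum>n\<in>UNIV. 1 + 3 * w n + 3 * w n ^ 2 + 2 * triv_char n)"
    by (intro sum.cong) (simp_all add: w_pow4)
  then show ?thesis
    by (simp add: sum.distrib sum_w sum_w2 sum_triv_char q_def flip: sum_distrib_left)
qed

section \<open>The second moment of the kernel\<close>

lemma sum_kernel_mult:
  "(\<Sum>k\<in>UNIV. cubic_kernel w k * g k)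
    = (\<Sum>x\<in>UNIV. \<Sum>y\<in>UNIV. \<Sum>z\<in>UNIV. w y * w z ^ 2 * g (x * y * z, x + y + z))"
  unfolding cubic_kernel_def split_def
  by (subst sum_fibres_mult[where f="\<lambda>t. w (fst (snd t)) * w (snd (snd t)) ^ 2"])
    (simp add: sum_UNIV_triple triple_prod_sum_def)

text \<open>Expanding \<open>cbrts\<close> gives three products, each with a factor \<open>w\<close>
  or \<open>w ^ 2\<close> in one variable that sums to 0. This orthogonality removes the cross terms
  from the second moment.\<close>

lemma sum_kernel_cbrts: "(\<Sum>k\<in>UNIV. cubic_kernel w k * cbrts (fst k)) = 0"
proof -
  have "w y * w z ^ 2 * cbrts (x * y * z) = w y * w z ^ 2 + w x * (w y ^ 2 * w z ^ 3) + w x ^ 2 * (w y ^ 3 * w z ^ 4)" for x y z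
    by (simp add: cbrts_def w_simps) Groebner_Basis.algebra
  then show ?thesis
    by (simp add: sum_kernel_mult sum.distrib sum_w sum_w2 flip: sum_distrib_left sum_distrib_right)
qed

text \<open>The condition is linear in \<open>x\<close> with coefficient \<open>a\<close>. If
  \<open>b * c \<noteq> 1\<close>, then \<open>x\<close> is determined by \<open>y\<close> and
  \<open>z\<close>. If \<open>b * c = 1\<close> and \<open>b \<noteq> 1\<close>, it says
  \<open>z = b * y\<close> with \<open>x\<close> free. If \<open>b = c = 1\<close>, it is void. The
  counts are written as increments so that each can be summed against \<open>w b ^ 2 * w c\<close>
  separately.\<close>

lemma sum_coincidences:
  assumes b0: "b \<noteq> 0" and c0: "c \<noteq> (0::'a)"
  shows "(\<Sum>x\<in>UNIV. \<Sum>y\<in>UNIV. \<Sum>z\<in>UNIV. triv_char y * triv_char z *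
      (if (1 / (b * c) - 1) * x + (b - 1) * y + (c - 1) * z = 0 then 1 else 0 :: complex))
    = (q - 1) ^ 2 + (if b * c = 1 then q - 1 else 0) + (if b = 1 \<and> c = 1 then q * (q - 1) * (q - 2) else 0)"
    (is "?L = _")
proof -
  define D :: "'a \<Rightarrow> complex" where "D v = (if v = 0 then 1 else 0)" for v
  define a where "a = 1 / (b * c) - 1"
  have a: "a = 0 \<longleftrightarrow> b * c = 1" using b0 c0 by (auto simp: a_def field_simps)
  have "?L = (\<Sum>y\<in>UNIV. \<Sum>x\<in>UNIV. \<Sum>z\<in>UNIV. triv_char y * triv_char z * D (a * x + ((b - 1) * y + (c - 1) * z)))"
    unfolding D_def a_def by (subst sum.swap) (simp add: add.assoc)
  also have "\<dots> = (\<Sum>y\<in>UNIV. \<Sum>z\<in>UNIV. \<Sum>x\<in>UNIV. triv_char y * triv_char z * D (a * x + ((b - 1) * y + (c - 1) * z)))"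
    by (rule sum.cong[OF refl], rule sum.swap)
  also have "\<dots> = (\<Sum>y\<in>UNIV. \<Sum>z\<in>UNIV. triv_char y * triv_char z *
      (if a = 0 then q * D ((b - 1) * y + (c - 1) * z) else 1))"
  proof -
    have "(\<Sum>x\<in>UNIV. D (a * x + e)) = (if a = 0 then q * D e else 1)" for e
      by (simp add: sum_affine q_def) (simp add: D_def)
    then show ?thesis by (simp flip: sum_distrib_left)
  qed
  also have "\<dots> = (q - 1) ^ 2 + (if b * c = 1 then q - 1 else 0) + (if b = 1 \<and> c = 1 then q * (q - 1) * (q - 2) else 0)"
  proof (cases "b * c = 1")
    case False
    then show ?thesis using a
      by (auto simp: sum_triv_char power2_eq_square q_def simp flip: sum_distrib_left sum_distrib_right)
  next
    case bc: True
    show ?thesis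
    proof (cases "b = 1")
      case True
      then have "c = 1" using bc by simp
      then show ?thesis using a True
        by (simp add: D_def sum_triv_char q_def flip: sum_distrib_left sum_distrib_right)
          (simp add: algebra_simps power2_eq_square)
    next
      case False
      have "(b - 1) * y + (c - 1) * z = 0 \<longleftrightarrow> z = b * y" for y z
      proof -
        have "b * ((b - 1) * y + (c - 1) * z) = (b - 1) * (b * y - z)" using bc by Groebner_Basis.algebra
        then show ?thesis using b0 False
          by (metis eq_iff_diff_eq_0 mult_eq_0_iff)
      qed
      then have "triv_char y * triv_char z * (q * D ((b - 1) * y + (c - 1) * z))
          = (if z = b * y then q * triv_char y else 0)" for y z
        using b0 by (auto simp: D_def triv_char_def)
      then show ?thesis using a bc False
        by (simp add: sum_triv_char q_def flip: sum_distrib_left) (simp add: algebra_simps power2_eq_square)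
    qed
  qed
  finally show ?thesis .
qed

text \<open>The second moment runs over pairs of points in a common fibre, and the weight
  \<open>w b ^ 2 * w c\<close> of a pair depends only on the ratios \<open>b\<close>,
  \<open>c\<close> of their last two coordinates. Against this weight the constant part and the
  \<open>b * c = 1\<close> part of \<open>sum_coincidences\<close> sum to 0; only
  \<open>b = c = 1\<close> remains.\<close>

lemma sum_norm_kernel:
  "(\<Sum>k\<in>UNIV. cubic_kernel w k * cnj (cubic_kernel w k)) = q * (q - 1) * (q - 2)"
proof -
  have cnj_kernel: "cnj (cubic_kernel w k)
      = (\<Sum>y\<in>UNIV. \<Sum>z\<in>UNIV. \<Sum>x\<in>UNIV. if (x * y * z, x + y + z) = k then w y ^ 2 * w z else 0)" for k
  proof -
    have "cnj (cubic_kernel w k) = (\<Sum>(x, y, z) | triple_prod_sum (x, y, z) = k. w y ^ 2 * w z)"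
      by (simp add: cubic_kernel_def split_def cnj_w w_pow4 flip: power_mult)
    also have "\<dots> = (\<Sum>t\<in>UNIV. if triple_prod_sum t = k then w (fst (snd t)) ^ 2 * w (snd (snd t)) else 0)"
      by (simp add: split_def sum.If_cases)
    also have "\<dots> = (\<Sum>x\<in>UNIV. \<Sum>y\<in>UNIV. \<Sum>z\<in>UNIV. if (x * y * z, x + y + z) = k then w y ^ 2 * w z else 0)"
      unfolding sum_UNIV_triple by (simp add: triple_prod_sum_def cong: if_cong)
    also have "\<dots> = (\<Sum>y\<in>UNIV. \<Sum>x\<in>UNIV. \<Sum>z\<in>UNIV. if (x * y * z, x + y + z) = k then w y ^ 2 * w z else 0)"
      by (rule sum.swap)
    also have "\<dots> = (\<Sum>y\<in>UNIV. \<Sum>z\<in>UNIV. \<Sum>x\<in>UNIV. if (x * y * z, x + y + z) = k then w y ^ 2 * w z else 0)"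
      by (rule sum.cong[OF refl], rule sum.swap)
    finally show ?thesis .
  qed
  \<comment> \<open>A second point of the fibre through \<open>(x, y, z)\<close> is \<open>(x / (b c), b y, c z)\<close>, and only the
    condition on the sum remains.\<close>
  have inner: "w y * w z ^ 2 * cnj (cubic_kernel w (x * y * z, x + y + z))
    = (\<Sum>b\<in>UNIV. \<Sum>c\<in>UNIV. w b ^ 2 * w c * (triv_char y * triv_char z *
      (if (1 / (b * c) - 1) * x + (b - 1) * y + (c - 1) * z = 0 then 1 else 0)))" for x y z
  proof (cases "y = 0 \<or> z = 0")
    case True
    then show ?thesis by (auto simp: w_simps triv_char_def)
  next
    case False
    then have y0: "y \<noteq> 0" and z0: "z \<noteq> 0" by auto
    have "cnj (cubic_kernel w (x * y * z, x + y + z))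
      = (\<Sum>b\<in>UNIV. \<Sum>c\<in>UNIV. \<Sum>x'\<in>UNIV. if (x' * (y * b) * (z * c), x' + y * b + z * c) = (x * y * z, x + y + z)
           then w (y * b) ^ 2 * w (z * c) else 0)"
      unfolding cnj_kernel
      by (subst sum_scale[OF y0, symmetric], subst sum_scale[OF z0, symmetric]) (rule refl)
    also have "\<dots> = (\<Sum>b\<in>UNIV. \<Sum>c\<in>UNIV. w y ^ 2 * w z * (w b ^ 2 * w c *
      (if (1 / (b * c) - 1) * x + (b - 1) * y + (c - 1) * z = 0 then 1 else 0)))"
    proof (intro sum.cong refl)
      fix b c
      show "(\<Sum>x'\<in>UNIV. if (x' * (y * b) * (z * c), x' + y * b + z * c) = (x * y * z, x + y + z)
           then w (y * b) ^ 2 * w (z * c) else 0)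
         = w y ^ 2 * w z * (w b ^ 2 * w c *
          (if (1 / (b * c) - 1) * x + (b - 1) * y + (c - 1) * z = 0 then 1 else 0))"
      proof (cases "b = 0 \<or> c = 0")
        case True
        then show ?thesis by (auto simp: w_simps intro!: sum.neutral)
      next
        case False
        then have bc: "b * c \<noteq> 0" by simp
        have "x' * (y * b) * (z * c) = x * y * z \<longleftrightarrow> x' = 1 / (b * c) * x" for x'
        proof -
          have "x' * (y * b) * (z * c) = (x' * (b * c)) * (y * z)" "x * y * z = x * (y * z)"
            by (simp_all add: mult_ac)
          then have "x' * (y * b) * (z * c) = x * y * z \<longleftrightarrow> x' * (b * c) = x"
            using y0 z0 by simp
          also have "\<dots> \<longleftrightarrow> x' = 1 / (b * c) * x" using bc by (auto simp: field_simps)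
          finally show ?thesis .
        qed
        then have "(\<Sum>x'\<in>UNIV. if (x' * (y * b) * (z * c), x' + y * b + z * c) = (x * y * z, x + y + z)
              then w (y * b) ^ 2 * w (z * c) else 0)
           = (\<Sum>x'\<in>UNIV. if x' = 1 / (b * c) * x then
                (if 1 / (b * c) * x + y * b + z * c = x + y + z then w (y * b) ^ 2 * w (z * c) else 0) else 0)"
          by (intro sum.cong) auto
        also have "\<dots> = (if 1 / (b * c) * x + y * b + z * c = x + y + z then w (y * b) ^ 2 * w (z * c) else 0)"
          by simp
        also have "1 / (b * c) * x + y * b + z * c = x + y + z
            \<longleftrightarrow> (1 / (b * c) - 1) * x + (b - 1) * y + (c - 1) * z = 0"
          unfolding eq_iff_diff_eq_0[of "1 / (b * c) * x + y * b + z * c"] by (simp add: algebra_simps)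
        finally show ?thesis by (simp add: w_simps power_mult_distrib)
      qed
    qed
    also have "\<dots> = w y ^ 2 * w z * (\<Sum>b\<in>UNIV. \<Sum>c\<in>UNIV. w b ^ 2 * w c *
      (if (1 / (b * c) - 1) * x + (b - 1) * y + (c - 1) * z = 0 then 1 else 0))"
      by (simp only: sum_distrib_left)
    finally have "w y * w z ^ 2 * cnj (cubic_kernel w (x * y * z, x + y + z))
      = (w y * w y ^ 2) * (w z * w z ^ 2) * (\<Sum>b\<in>UNIV. \<Sum>c\<in>UNIV. w b ^ 2 * w c *
      (if (1 / (b * c) - 1) * x + (b - 1) * y + (c - 1) * z = 0 then 1 else 0))"
      by (simp only: mult_ac)
    also have "\<dots> = triv_char y * triv_char z * (\<Sum>b\<in>UNIV. \<Sum>c\<in>UNIV. w b ^ 2 * w c *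
      (if (1 / (b * c) - 1) * x + (b - 1) * y + (c - 1) * z = 0 then 1 else 0))"
      by (simp only: w_mult_square)
    finally show ?thesis by (simp only: sum_distrib_left mult_ac)
  qed
  let ?N = "\<lambda>x y z b c. triv_char y * triv_char z *
      (if (1 / (b * c) - 1) * x + (b - 1) * y + (c - 1) * z = (0::'a) then 1 else 0 :: complex)"
  have "(\<Sum>k\<in>UNIV. cubic_kernel w k * cnj (cubic_kernel w k))
     = (\<Sum>x\<in>UNIV. \<Sum>y\<in>UNIV. \<Sum>z\<in>UNIV. \<Sum>b\<in>UNIV. \<Sum>c\<in>UNIV. w b ^ 2 * w c * ?N x y z b c)"
    unfolding sum_kernel_mult inner ..
  also have "\<dots> = (\<Sum>t\<in>UNIV. \<Sum>b\<in>UNIV. \<Sum>c\<in>UNIV. w b ^ 2 * w c * ?N (fst t) (fst (snd t)) (snd (snd t)) b c)"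
    by (simp only: sum_UNIV_triple fst_conv snd_conv)
  also have "\<dots> = (\<Sum>b\<in>UNIV. \<Sum>t\<in>UNIV. \<Sum>c\<in>UNIV. w b ^ 2 * w c * ?N (fst t) (fst (snd t)) (snd (snd t)) b c)"
    by (rule sum.swap)
  also have "\<dots> = (\<Sum>b\<in>UNIV. \<Sum>c\<in>UNIV. \<Sum>t\<in>UNIV. w b ^ 2 * w c * ?N (fst t) (fst (snd t)) (snd (snd t)) b c)"
    by (rule sum.cong[OF refl], rule sum.swap)
  also have "\<dots> = (\<Sum>b\<in>UNIV. \<Sum>c\<in>UNIV. w b ^ 2 * w c *
      (\<Sum>x\<in>UNIV. \<Sum>y\<in>UNIV. \<Sum>z\<in>UNIV. ?N x y z b c))"
    by (simp only: sum_UNIV_triple fst_conv snd_conv sum_distrib_left)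
  also have "\<dots> = (\<Sum>b\<in>UNIV. \<Sum>c\<in>UNIV. w b ^ 2 * w c * ((q - 1) ^ 2
      + (if b * c = 1 then q - 1 else 0) + (if b = 1 \<and> c = 1 then q * (q - 1) * (q - 2) else 0)))"
  proof (intro sum.cong refl)
    fix b c
    show "w b ^ 2 * w c * (\<Sum>x\<in>UNIV. \<Sum>y\<in>UNIV. \<Sum>z\<in>UNIV. ?N x y z b c) = w b ^ 2 * w c * ((q - 1) ^ 2
      + (if b * c = 1 then q - 1 else 0) + (if b = 1 \<and> c = 1 then q * (q - 1) * (q - 2) else 0))"
      by (cases "b = 0 \<or> c = 0") (auto simp: w_simps sum_coincidences)
  qed
  also have "\<dots> = (\<Sum>b\<in>UNIV. \<Sum>c\<in>UNIV. w b ^ 2 * w c * (q - 1) ^ 2)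
      + (\<Sum>b\<in>UNIV. \<Sum>c\<in>UNIV. w b ^ 2 * w c * (if b * c = 1 then q - 1 else 0))
      + (\<Sum>b\<in>UNIV. \<Sum>c\<in>UNIV. w b ^ 2 * w c * (if b = 1 \<and> c = 1 then q * (q - 1) * (q - 2) else 0))"
    by (simp only: distrib_left sum.distrib)
  also have "(\<Sum>b\<in>UNIV. \<Sum>c\<in>UNIV. w b ^ 2 * w c * (q - 1) ^ 2) = 0"
    by (simp add: sum_w flip: sum_distrib_left sum_distrib_right)
  also have "(\<Sum>b\<in>UNIV. \<Sum>c\<in>UNIV. w b ^ 2 * w c * (if b * c = 1 then q - 1 else 0)) = 0"
  proof -
    have "(\<Sum>c\<in>UNIV. w b ^ 2 * w c * (if b * c = 1 then q - 1 else 0)) = w b * (q - 1)" for b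
    proof (cases "b = 0")
      case False
      then have "b * c = 1 \<longleftrightarrow> c = inverse b" for c by (auto simp: field_simps)
      then have "(\<Sum>c\<in>UNIV. w b ^ 2 * w c * (if b * c = 1 then q - 1 else 0)) = w b ^ 2 * w (inverse b) * (q - 1)"
        by (simp add: if_distrib cong: if_cong)
      then show ?thesis using mult_char_eq_0_iff[OF mult_char_w, of b] False
        by (simp add: w_simps power2_eq_square)
    qed (simp add: w_simps)
    then show ?thesis by (simp add: sum_w flip: sum_distrib_right)
  qed
  also have "(\<Sum>b\<in>UNIV. \<Sum>c\<in>UNIV. w b ^ 2 * w c * (if b = 1 \<and> c = 1 then q * (q - 1) * (q - 2) else 0))
      = q * (q - 1) * (q - 2)"
  proof -
    have "(\<Sum>c\<in>UNIV. w b ^ 2 * w c * (if b = 1 \<and> c = 1 then q * (q - 1) * (q - 2) else 0))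
       = (if b = 1 then q * (q - 1) * (q - 2) else 0)" for b
      by (cases "b = 1") (simp_all add: w_simps if_distrib cong: if_cong)
    then show ?thesis by simp
  qed
  finally show ?thesis by simp
qed

text \<open>With the cross terms gone, the moment is
  \<open>q * (q - 1) * (q - 2) + q * (3 * q - 2)\<close>, which is \<open>q ^ 3\<close>.\<close>

lemma sum_norm_kernel_cbrts:
  "(\<Sum>k\<in>UNIV. norm (cubic_kernel w k + cbrts (fst k)) ^ 2) = real CARD('a) ^ 3"
proof -
  have c1: "(\<Sum>k\<in>UNIV. cbrts (fst k) * cnj (cubic_kernel w k)) = 0"
    using arg_cong[OF sum_kernel_cbrts, of cnj] by (simp add: cnj_cbrts mult.commute)
  have c2: "(\<Sum>k\<in>(UNIV :: ('a \<times> 'a) set). cbrts (fst k) * cbrts (fst k)) = q * (3 * q - 2)"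
  proof -
    have "(\<Sum>k\<in>(UNIV :: ('a \<times> 'a) set). cbrts (fst k) * cbrts (fst k))
        = (\<Sum>n\<in>UNIV. \<Sum>s\<in>(UNIV::'a set). cbrts n * cbrts n)"
      unfolding UNIV_Times_UNIV[symmetric] sum.cartesian_product split_def ..
    then show ?thesis by (simp add: sum_cbrts_square q_def flip: sum_distrib_left)
  qed
  have "complex_of_real (\<Sum>k\<in>UNIV. norm (cubic_kernel w k + cbrts (fst k)) ^ 2)
     = (\<Sum>k\<in>UNIV. (cubic_kernel w k + cbrts (fst k)) * cnj (cubic_kernel w k + cbrts (fst k)))"
    by (simp only: of_real_sum complex_norm_square)
  also have "\<dots> = (\<Sum>k\<in>UNIV. cubic_kernel w k * cnj (cubic_kernel w k)) + (\<Sum>k\<in>UNIV. cubic_kernel w k * cbrts (fst k))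
     + (\<Sum>k\<in>UNIV. cbrts (fst k) * cnj (cubic_kernel w k)) + (\<Sum>k\<in>(UNIV :: ('a \<times> 'a) set). cbrts (fst k) * cbrts (fst k))"
    by (simp add: cnj_cbrts algebra_simps sum.distrib)
  also have "\<dots> = complex_of_real (real CARD('a) ^ 3)"
    unfolding sum_norm_kernel sum_kernel_cbrts c1 c2 by (simp add: q_def algebra_simps power3_eq_cube)
  finally show ?thesis using of_real_eq_iff by blast
qed


section \<open>Cube roots of unity and the nodal cubics\<close>

lemma exists_cube_root_of_unity: "\<exists>e::'a. e * e + e + 1 = 0 \<and> e \<noteq> 1"
proof (rule ccontr)
  assume no: "\<nexists>e::'a. e * e + e + 1 = 0 \<and> e \<noteq> 1"
  have "inj (\<lambda>x::'a. x ^ 3)"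
  proof (rule injI)
    fix x y :: 'a
    assume xy: "x ^ 3 = y ^ 3"
    show "x = y"
    proof (cases "y = 0")
      case False
      then have "(x / y) ^ 3 = 1" using xy by (simp add: power_divide)
      then have "(x / y - 1) * (x / y * (x / y) + x / y + 1) = 0"
        by Groebner_Basis.algebra
      then have "x / y = 1" using no by (metis eq_iff_diff_eq_0 mult_eq_0_iff)
      then show ?thesis using False by simp
    qed (use xy in simp)
  qed
  \<comment> \<open>If every element is a cube, then \<open>w\<close>, whose cube is trivial, is
    itself trivial.\<close>
  then have "surj (\<lambda>x::'a. x ^ 3)" by (rule finite_UNIV_inj_surj[OF finite])
  then have "w x = triv_char x" for x
    using w_pow3 by (metis (no_types) mult_char_0 mult_char_power mult_char_w power_zero_numeral surjD triv_char_def)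
  then show False using w_nontriv by blast
qed

text \<open>In characteristic 3 the polynomial \<open>e * e + e + 1\<close> is
  \<open>(e - 1) * (e - 1)\<close>, so it has no root other than 1.\<close>

lemma three_nonzero: "(3::'a) \<noteq> 0"
proof
  assume 3: "(3::'a) = 0"
  obtain e :: 'a where e: "e * e + e + 1 = 0" "e \<noteq> 1" using exists_cube_root_of_unity by blast
  have "(e - 1) * (e - 1) = (e * e + e + 1) - 3 * e" by (simp add: algebra_simps)
  then show False using e 3 by simp
qed

text \<open>Projection from the node parametrizes the curve by the slope \<open>m\<close>. At most
  four slopes are lost: 0 and -1, where a denominator vanishes, and the tangent slopes in
  \<open>R\<close>, where the further point falls back onto the node. The node itself adds one
  point, which leaves the deficit 3.\<close>

lemma nodal_cubic_points:
  assumes u: "(u::'a) \<noteq> 0"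
  shows "CARD('a) \<le> card {t. triple_prod_sum t = (u ^ 3, 3 * u)} + 3"
proof -
  define R where "R = {m::'a. m * m + m + 1 = 0}"
  define M where "M = - ({0, - 1} \<union> R)"
  \<comment> \<open>The line of slope \<open>m\<close> through the node \<open>(u, u, u)\<close> meets the cubic in one further point.\<close>
  define p where "p m = (u * (- 1 / (m * (1 + m))), u * (- (m * m) / (1 + m)), u * ((1 + m) * (1 + m) / m))" for m
  let ?P = "{t. triple_prod_sum t = (u ^ 3, 3 * u)}"
  have M: "m \<noteq> 0" "1 + m \<noteq> 0" "m * m + m + 1 \<noteq> 0" if "m \<in> M" for m
    using that by (auto simp: M_def R_def add_eq_0_iff)
  \<comment> \<open>After division by \<open>u\<close>, the offsets from the node are
    \<open>d\<close>, \<open>m * d\<close> and \<open>- (1 + m) * d\<close> with a common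
    \<open>d\<close>. They add up to 0, which gives the coordinate sum \<open>3 * u\<close>.\<close>
  have x1: "- 1 / (m * (1 + m)) - 1 = - (m * m + m + 1) / (m * (1 + m))"
    and y1: "- (m * m) / (1 + m) - 1 = m * (- (m * m + m + 1) / (m * (1 + m)))"
    and z1: "(1 + m) * (1 + m) / m - 1 = - (1 + m) * (- (m * m + m + 1) / (m * (1 + m)))"
    if "m \<in> M" for m
    using M[OF that] by (simp_all add: divide_simps) (simp_all add: algebra_simps)
  have nz: "- 1 / (m * (1 + m)) - 1 \<noteq> 0" if "m \<in> M" for m
    unfolding x1[OF that] using M[OF that] by (metis divide_eq_0_iff mult_eq_0_iff neg_equal_0_iff_equal)
  have R2: "card R \<le> 2"
  proof (cases "R = {}")
    case False
    then obtain e :: 'a where e: "e * e + e + 1 = 0" by (auto simp: R_def)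
    have "R \<subseteq> {e, - 1 - e}"
    proof
      fix m assume "m \<in> R"
      then have "m * m + m + 1 = 0" by (simp add: R_def)
      then have "(m - e) * (m - (- 1 - e)) = 0" using e by Groebner_Basis.algebra
      then show "m \<in> {e, - 1 - e}" by simp
    qed
    then have "card R \<le> card {e, - 1 - e}" by (intro card_mono) auto
    also have "\<dots> \<le> 2" by (simp add: card_insert_if)
    finally show ?thesis .
  qed simp
  have "card ({0, - 1} \<union> R) \<le> card {0, - 1 :: 'a} + card R" by (rule card_Un_le)
  also have "\<dots> \<le> 4" using R2 by (simp add: card_insert_if)
  finally have cM: "CARD('a) \<le> card M + 4"
    unfolding M_def by (simp add: Compl_eq_Diff_UNIV card_Diff_subset)
  have "inj_on p M"
  proof (rule inj_onI)
    fix m n assume m: "m \<in> M" and n: "n \<in> M" and "p m = p n"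
    then have eq: "- 1 / (m * (1 + m)) = - 1 / (n * (1 + n))" "- (m * m) / (1 + m) = - (n * n) / (1 + n)"
      using u unfolding p_def prod.inject mult_cancel_left by blast+
    \<comment> \<open>The slope is recovered as the ratio of the second offset to the first, which
      is nonzero.\<close>
    have "m * (- 1 / (m * (1 + m)) - 1) = - (m * m) / (1 + m) - 1"
      by (simp only: y1[OF m] x1[OF m])
    also have "\<dots> = n * (- 1 / (m * (1 + m)) - 1)"
      by (simp only: eq y1[OF n] x1[OF n])
    finally show "m = n" using nz[OF m] by simp
  qed
  moreover have "(u, u, u) \<notin> p ` M"
  proof
    assume "(u, u, u) \<in> p ` M"
    then obtain m where "m \<in> M" "u = u * (- 1 / (m * (1 + m)))" by (auto simp: p_def)
    then show False using nz u by (metis diff_self mult_cancel_left1)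
  qed
  ultimately have "card (insert (u, u, u) (p ` M)) = card M + 1"
    by (simp add: card_image)
  moreover have "insert (u, u, u) (p ` M) \<subseteq> ?P"
  proof -
    have "triple_prod_sum (p m) = (u ^ 3, 3 * u)" if m: "m \<in> M" for m
    proof -
      have P: "- 1 / (m * (1 + m)) * (- (m * m) / (1 + m)) * ((1 + m) * (1 + m) / m) = 1"
        using M[OF m] by (simp add: divide_simps)
      have S: "(- 1 / (m * (1 + m)) - 1) + (- (m * m) / (1 + m) - 1) + ((1 + m) * (1 + m) / m - 1) = 0"
        unfolding x1[OF m] y1[OF m] z1[OF m] by Groebner_Basis.algebra
      have "triple_prod_sum (u * a, u * b, u * c)
          = (u ^ 3 * (a * b * c), u * ((a - 1) + (b - 1) + (c - 1)) + 3 * u)" for a b c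
        by (simp add: triple_prod_sum_def algebra_simps power3_eq_cube)
      then show ?thesis unfolding p_def by (simp only: P S) simp
    qed
    moreover have "triple_prod_sum (u, u, u) = (u ^ 3, 3 * u)"
      by (simp add: triple_prod_sum_def power3_eq_cube algebra_simps)
    ultimately show ?thesis by auto
  qed
  then have "card (insert (u, u, u) (p ` M)) \<le> card ?P" by (intro card_mono) auto
  ultimately show ?thesis using cM by linarith
qed

text \<open>On this curve \<open>y * (z - u) ^ 3 = z * (y - u) ^ 3\<close>, so \<open>y / z\<close>
  is a cube away from the node and every summand is 1. Where \<open>z = u\<close>, the identity
  degenerates, but then \<open>y = u\<close> as well.\<close>

lemma kernel_nodal_cubic:
  assumes u: "(u::'a) \<noteq> 0"
  shows "cubic_kernel w (u ^ 3, 3 * u) = of_nat (card {t. triple_prod_sum t = (u ^ 3, 3 * u)})"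
proof -
  have "w y * w z ^ 2 = 1" if "triple_prod_sum (x, y, z) = (u ^ 3, 3 * u)" for x y z
  proof -
    have xyz: "x * y * z = u ^ 3" and s: "x + y + z = 3 * u"
      using that by (auto simp: triple_prod_sum_def)
    then have y0: "y \<noteq> 0" and z0: "z \<noteq> 0" using u by auto
    show ?thesis
    proof (cases "z = u")
      case True
      have "(y - u) * (y - u) = y * (x + y + z - 3 * u) + u * u - x * y"
        using True by (simp add: algebra_simps)
      moreover have "x * y = u * u" using xyz u True by (simp add: power3_eq_cube)
      ultimately have "y = u" using s by simp
      then show ?thesis using True w_mult_square[of u] u by (simp add: triv_char_def)
    next
      case False
      have "y * (z - u) ^ 3 = z * (y - u) ^ 3" using xyz s by Groebner_Basis.algebra
      then have "w (y * (z - u) ^ 3) = w (z * (y - u) ^ 3)" by simp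
      moreover from \<open>y * (z - u) ^ 3 = z * (y - u) ^ 3\<close> have "y - u \<noteq> 0" using False y0 by auto
      ultimately have "w y = w z" using False by (simp add: w_simps w_pow3)
      then show ?thesis using w_mult_square[of z] z0 by (simp add: triv_char_def)
    qed
  qed
  then have "cubic_kernel w (u ^ 3, 3 * u) = (\<Sum>t | triple_prod_sum t = (u ^ 3, 3 * u). 1)"
    unfolding cubic_kernel_def by (intro sum.cong) auto
  then show ?thesis by simp
qed

text \<open>The case \<open>u = 0\<close> of the special points: only triples
  \<open>(0, y, - y)\<close> contribute. Together with \<open>cbrts 0 = 1\<close> the value is
  exactly \<open>q\<close>.\<close>

lemma kernel_zero: "cubic_kernel w (0, 0) = q - 1"
proof -
  have "cubic_kernel w (0, 0) = (\<Sum>t\<in>(\<lambda>y. (0::'a, y, - y)) ` UNIV. w (fst (snd t)) * w (snd (snd t)) ^ 2)"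
    unfolding cubic_kernel_def split_def
  proof (rule sum.mono_neutral_right)
    show "\<forall>t\<in>{t. triple_prod_sum (fst t, fst (snd t), snd (snd t)) = (0, 0)} - range (\<lambda>y. (0::'a, y, - y)).
        w (fst (snd t)) * w (snd (snd t)) ^ 2 = 0"
      by (auto simp: triple_prod_sum_def w_simps add_eq_0_iff)
  qed (auto simp: triple_prod_sum_def)
  also have "\<dots> = (\<Sum>y\<in>UNIV. w y * w (- y) ^ 2)"
    by (subst sum.reindex) (auto simp: inj_on_def)
  also have "\<dots> = (\<Sum>y\<in>UNIV. triv_char (y::'a))"
  proof (rule sum.cong[OF refl])
    fix y
    have "w (- y) = w y" using mult_char_mult[OF mult_char_w, of "- 1" y] by (simp add: w_minus_1)
    then show "w y * w (- y) ^ 2 = triv_char y" by (simp add: w_mult_square)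
  qed
  finally show ?thesis by (simp add: sum_triv_char q_def)
qed

section \<open>Evaluation of the kernel and the cubic transformation\<close>

theorem cubic_kernel_eq:
  "cubic_kernel w k + cbrts (fst k) = (if k \<in> range (\<lambda>u. (u ^ 3, 3 * u)) then q else 0)"
proof -
  define G where "G k = cubic_kernel w k + cbrts (fst k)" for k
  define D where "D = range (\<lambda>u::'a. (u ^ 3, 3 * u))"
  let ?n = "real CARD('a)"
  have inj: "inj (\<lambda>u::'a. (u ^ 3, 3 * u))" using three_nonzero by (auto intro!: injI)
  have GD: "\<exists>r. G k = complex_of_real r \<and> ?n \<le> r" if k: "k \<in> D" for k
  proof -
    obtain u where u: "k = (u ^ 3, 3 * u)" using k by (auto simp: D_def)
    show ?thesis
    proof (cases "u = 0")
      case True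
      then have "G k = complex_of_real ?n"
        unfolding G_def u by (simp add: kernel_zero cbrts_def w_simps q_def)
      then show ?thesis by blast
    next
      case False
      let ?P = "{t. triple_prod_sum t = (u ^ 3, 3 * u)}"
      \<comment> \<open>These three cube roots make up exactly for the deficit 3 in
        \<open>nodal_cubic_points\<close>.\<close>
      have "cbrts (u ^ 3) = 3" by (simp add: cbrts_def w_simps w_pow3 False)
      then have "G k = complex_of_real (real (card ?P) + 3)"
        unfolding G_def u by (simp add: kernel_nodal_cubic[OF False])
      moreover have "?n \<le> real (card ?P) + 3"
        using nodal_cubic_points[OF False] by linarith
      ultimately show ?thesis by blast
    qed
  qed
  have ge: "?n ^ 2 \<le> norm (G k) ^ 2" if "k \<in> D" for k
    using GD[OF that] by (auto intro!: power_mono)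
  have cD: "card D = CARD('a)" by (simp add: D_def card_image[OF inj])
  \<comment> \<open>The set \<open>D\<close> has \<open>?n\<close> points, so subtracting
    \<open>?n ^ 2\<close> at each uses up the whole second moment \<open>?n ^ 3\<close>. The
    differences are nonnegative, hence all 0.\<close>
  have "(\<Sum>k\<in>UNIV. norm (G k) ^ 2 - (if k \<in> D then ?n ^ 2 else 0)) = 0"
    using sum_norm_kernel_cbrts
    by (simp add: G_def sum_subtractf sum.If_cases cD power2_eq_square power3_eq_cube)
  moreover have "0 \<le> norm (G k) ^ 2 - (if k \<in> D then ?n ^ 2 else 0)" for k
    using ge[of k] by simp
  ultimately have "norm (G k) ^ 2 - (if k \<in> D then ?n ^ 2 else 0) = 0"
    by (intro sum_nonneg_0[of UNIV "\<lambda>k. norm (G k) ^ 2 - (if k \<in> D then ?n ^ 2 else 0)"]) simp_all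
  \<comment> \<open>On \<open>D\<close> the value is real and positive by \<open>GD\<close>, so its
    norm determines it.\<close>
  then have "G k = (if k \<in> D then q else 0)"
    using GD[of k] by (auto simp: q_def split: if_splits)
  then show ?thesis by (simp add: G_def D_def)
qed

text \<open>With \<open>g\<close> as below, the left side times \<open>q\<close> is the sum of
  \<open>q * g\<close> over the special points, so \<open>cubic_kernel_eq\<close> applies. The
  \<open>cbrts\<close> part dies on summing \<open>f\<close> over \<open>s\<close>. In the kernel
  part the argument of \<open>f\<close> is linear in \<open>x\<close> with coefficient
  \<open>c * y * z + 1 / 3\<close>, so only \<open>y * z = k\<close> survives, with a factor
  \<open>q\<close>.\<close>

theorem cubic_transformation:
  fixes f :: "'a \<Rightarrow> complex"
  assumes f: "(\<Sum>x\<in>UNIV. f x) = 0" and c: "c \<noteq> 0" and k: "k = - 1 / (3 * c)"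
  shows "(\<Sum>u\<in>UNIV. f (c * u ^ 3 + u + 1))
    = (\<Sum>y\<in>UNIV. w y * w (k / y) ^ 2 * f (1 + (y + k / y) / 3))"
proof -
  define g where "g = (\<lambda>(n, s). f (c * n + s / 3 + 1))"
  have q0: "q \<noteq> 0" by (simp add: q_def)
  have inj: "inj (\<lambda>u::'a. (u ^ 3, 3 * u))" using three_nonzero by (auto intro!: injI)
  have "q * (\<Sum>u\<in>UNIV. f (c * u ^ 3 + u + 1)) = (\<Sum>u\<in>UNIV. q * g (u ^ 3, 3 * u))"
    using three_nonzero by (simp add: g_def sum_distrib_left)
  also have "\<dots> = (\<Sum>k\<in>range (\<lambda>u. (u ^ 3, 3 * u)). q * g k)"
    by (simp add: sum.reindex[OF inj])
  also have "\<dots> = (\<Sum>k\<in>UNIV. (cubic_kernel w k + cbrts (fst k)) * g k)"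
    unfolding cubic_kernel_eq by (rule sum.mono_neutral_cong_left) auto
  also have "\<dots> = (\<Sum>k\<in>UNIV. cubic_kernel w k * g k) + (\<Sum>k\<in>UNIV. cbrts (fst k) * g k)"
    by (simp add: distrib_right sum.distrib)
  also have "(\<Sum>k\<in>UNIV. cbrts (fst k) * g k) = (\<Sum>n\<in>UNIV. \<Sum>s\<in>UNIV. cbrts n * g (n, s))"
    unfolding UNIV_Times_UNIV[symmetric] sum.cartesian_product by (simp add: split_def)
  also have "\<dots> = 0"
  proof -
    have "(\<Sum>s\<in>UNIV. g (n, s)) = 0" for n
      using sum_affine[of "1 / 3" f "c * n + 1"] f three_nonzero by (simp add: g_def algebra_simps)
    then show ?thesis by (simp flip: sum_distrib_left)
  qed
  also have "(\<Sum>k\<in>UNIV. cubic_kernel w k * g k)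
      = (\<Sum>x\<in>UNIV. \<Sum>y\<in>UNIV. \<Sum>z\<in>UNIV. w y * w z ^ 2 * g (x * y * z, x + y + z))"
    by (rule sum_kernel_mult)
  also have "\<dots> = (\<Sum>y\<in>UNIV. \<Sum>x\<in>UNIV. \<Sum>z\<in>UNIV. w y * w z ^ 2 * g (x * y * z, x + y + z))"
    by (rule sum.swap)
  also have "\<dots> = (\<Sum>y\<in>UNIV. \<Sum>z\<in>UNIV. \<Sum>x\<in>UNIV. w y * w z ^ 2 * g (x * y * z, x + y + z))"
    by (rule sum.cong[OF refl], rule sum.swap)
  also have "\<dots> = (\<Sum>y\<in>UNIV. q * (w y * w (k / y) ^ 2 * f (1 + (y + k / y) / 3)))"
  proof (rule sum.cong[OF refl])
    fix y
    show "(\<Sum>z\<in>UNIV. \<Sum>x\<in>UNIV. w y * w z ^ 2 * g (x * y * z, x + y + z))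
      = q * (w y * w (k / y) ^ 2 * f (1 + (y + k / y) / 3))"
    proof (cases "y = 0")
      case False
      have "(\<Sum>x\<in>UNIV. w y * w z ^ 2 * g (x * y * z, x + y + z))
        = (if z = k / y then q * (w y * w (k / y) ^ 2 * f (1 + (y + k / y) / 3)) else 0)" for z
      proof -
        have "(\<Sum>x\<in>UNIV. w y * w z ^ 2 * g (x * y * z, x + y + z))
           = w y * w z ^ 2 * (\<Sum>x\<in>UNIV. f ((c * y * z + 1 / 3) * x + (1 + (y + z) / 3)))"
          by (simp add: g_def sum_distrib_left algebra_simps add_divide_distrib)
        also have "\<dots> = w y * w z ^ 2 * (if c * y * z + 1 / 3 = 0 then q * f (1 + (y + z) / 3) else 0)"
          unfolding q_def by (simp only: sum_zero_affine[OF f])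
        also have "c * y * z + 1 / 3 = 0 \<longleftrightarrow> z = k / y"
        proof -
          have "3 * c * y * (z - k / y) = 3 * (c * y * z + 1 / 3)"
            using c False three_nonzero by (simp add: k field_simps)
          then show ?thesis using c False three_nonzero
            by (metis eq_iff_diff_eq_0 mult_eq_0_iff)
        qed
        finally show ?thesis by auto
      qed
      then show ?thesis by simp
    qed (simp add: w_simps)
  qed
  also have "\<dots> = q * (\<Sum>y\<in>UNIV. w y * w (k / y) ^ 2 * f (1 + (y + k / y) / 3))"
    by (simp add: sum_distrib_left)
  finally show ?thesis using q0 by simp
qed

end

subsection \<open>Characters of order twelve\<close>

text \<open>Inverting \<open>y\<close> changes the argument only by the factor \<open>y ^ 4\<close>
  and produces the Legendre form of the elliptic curve.\<close>

lemma period_quad_char: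
  fixes lam :: "'a::{finite,field}"
  assumes Q: "mult_char (quad_char :: 'a \<Rightarrow> complex)"
  shows "period21 quad_char quad_char triv_char lam
    = (\<Sum>x\<in>UNIV. quad_char (x * (x - 1) * (x - lam)))"
proof -
  have cnj: "cnj (quad_char v) = quad_char v" for v :: 'a by (simp add: quad_char_def)
  have "period21 quad_char quad_char triv_char lam
     = (\<Sum>y\<in>UNIV. quad_char (y * (1 - y) * (1 - lam * y)))"
    unfolding period21_def char_conj_def cnj
    by (rule sum.cong) (auto simp: mult_char_mult[OF Q] triv_char_def mult_char_0[OF Q])
  also have "\<dots> = (\<Sum>y\<in>UNIV. quad_char (1 / y * (1 - 1 / y) * (1 - lam * (1 / y))))"
    by (rule sum_divide_left[symmetric]) simp
  also have "\<dots> = (\<Sum>x\<in>UNIV. quad_char (x * (x - 1) * (x - lam)))"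
  proof (rule sum.cong[OF refl])
    fix y
    show "quad_char (1 / y * (1 - 1 / y) * (1 - lam * (1 / y))) = quad_char (y * (y - 1) * (y - lam))"
    proof (cases "y = 0")
      case False
      then have "y * (y - 1) * (y - lam) = (y * y) * (y * y) * (1 / y * (1 - 1 / y) * (1 - lam * (1 / y)))"
        by (simp add: field_simps)
      then show ?thesis using quad_char_square[OF False] by (simp only: mult_char_mult[OF Q]) simp
    qed simp
  qed
  finally show ?thesis .
qed

locale order12_character =
  fixes e :: "'a::{finite,field} \<Rightarrow> complex"
  assumes primitive: "primitive_char_of_order 12 e"
begin

lemma mult_char_e: "mult_char e"
  using primitive by (simp add: primitive_char_of_order_def)

lemmas e_simps = mult_char_simps[OF mult_char_e]

lemma e_pow12: "x \<noteq> 0 \<Longrightarrow> e x ^ 12 = 1"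
  using primitive unfolding primitive_char_of_order_def
  by (metis char_pow_def triv_char_def)

lemma e_nonzero: "x \<noteq> 0 \<Longrightarrow> e x \<noteq> 0"
  by (simp add: mult_char_eq_0_iff[OF mult_char_e])

lemma char_pow_nontriv: "0 < k \<Longrightarrow> k < 12 \<Longrightarrow> char_pow e k \<noteq> triv_char"
  using primitive by (simp add: primitive_char_of_order_def)

lemma e_minus_1: "e (- 1) ^ 2 = 1"
  by (rule mult_char_minus_square[OF mult_char_e])

lemma cnj_e: "cnj (e x) = inverse (e x)"
proof (cases "x = 0")
  case False
  have "norm (e x) ^ 12 = 1 ^ 12" by (simp add: e_pow12[OF False] flip: norm_power)
  then have "norm (e x) = 1" by (rule power_eq_imp_eq_base) simp_all
  then have "e x * cnj (e x) = 1" by (simp add: complex_norm_square[symmetric])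
  then show ?thesis by (metis inverse_unique)
qed (simp add: e_simps)

lemma char_pow_12: "char_pow e 12 = triv_char"
  using primitive by (simp add: primitive_char_of_order_def)

lemma quad_char_eq: "quad_char = char_pow e 6"
proof (rule quadratic_char_unique[symmetric])
  show "char_pow (char_pow e 6) 2 = triv_char"
    using char_pow_12 by (simp add: char_pow_def fun_eq_iff flip: power_mult)
qed (simp_all add: mult_char_char_pow mult_char_e char_pow_nontriv)

lemma quad_char_e: "quad_char x = e x ^ 6"
  by (simp add: quad_char_eq char_pow_def)

lemma mult_char_quad: "mult_char (quad_char :: 'a \<Rightarrow> complex)"
  unfolding quad_char_eq by (simp add: mult_char_char_pow mult_char_e)

lemma quad_nontriv: "(quad_char :: 'a \<Rightarrow> complex) \<noteq> triv_char"
  unfolding quad_char_eq by (simp add: char_pow_nontriv)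

lemma quad_char_minus_1: "quad_char (- 1 :: 'a) = 1"
  using e_minus_1 power_mult[of "e (- 1)" 2 3] by (simp add: quad_char_e)

text \<open>In characteristic 2 squaring is injective, hence surjective, and
  \<open>quad_char\<close> would be trivial.\<close>

lemma two_nonzero: "(2::'a) \<noteq> 0"
proof
  assume 2: "(2::'a) = 0"
  then have "- y = y" for y :: 'a by (metis add_eq_0_iff mult_2 mult_zero_left)
  then have "inj (\<lambda>x::'a. x * x)" by (auto intro!: injI simp: square_eq_iff)
  then have "surj (\<lambda>x::'a. x * x)" by (rule finite_UNIV_inj_surj[OF finite])
  then have "(quad_char :: 'a \<Rightarrow> complex) = triv_char"
    by (auto simp: fun_eq_iff quad_char_def triv_char_def) (metis surjD)
  then show False using quad_nontriv by blast
qed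

sublocale cubic: cubic_character "char_pow e 4" "of_nat CARD('a)"
proof unfold_locales
  show "char_pow (char_pow e 4) 3 = triv_char"
    using char_pow_12 by (simp add: char_pow_def fun_eq_iff flip: power_mult)
qed (simp_all add: mult_char_char_pow mult_char_e char_pow_nontriv)

lemma four_nonzero: "(4::'a) \<noteq> 0"
proof -
  have "(4::'a) = 2 * 2" by simp
  then show ?thesis using two_nonzero by (metis mult_eq_0_iff)
qed

lemma twentyseven_nonzero: "(27::'a) \<noteq> 0"
proof -
  have "(27::'a) = 3 * 3 * 3" by simp
  then show ?thesis using cubic.three_nonzero by (metis mult_eq_0_iff)
qed

text \<open>A primitive cube root of unity \<open>t\<close> gives
  \<open>- 3 = (2 * t + 1) * (2 * t + 1)\<close>, and -1 is a square as well.\<close>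

lemma quad_char_3: "quad_char (3::'a) = 1"
proof -
  obtain t :: 'a where t: "t * t + t + 1 = 0" using cubic.exists_cube_root_of_unity by blast
  have "3 * (- 1) = (2 * t + 1) * (2 * t + 1) - 4 * (t * t + t + 1)" by (simp add: algebra_simps)
  then have sq: "3 * (- 1) = (2 * t + 1) * (2 * t + 1)" using t by simp
  then have "2 * t + 1 \<noteq> 0" using cubic.three_nonzero by auto
  then show ?thesis using quad_char_eqI[OF mult_char_quad sq] quad_char_minus_1 by simp
qed

section \<open>The order-twelve period, the elliptic sum and their comparison\<close>

lemma period_reflection:
  assumes W: "1 - z \<noteq> 0"
  shows "period21 e (char_pow e 5) triv_char z = e (1 - z) ^ 7 *
    (\<Sum>y\<in>UNIV. e ((1 - y) / y) ^ 7 * e (1 + (1 / (1 - z) - 1) * y))"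
proof -
  define K where "K = 1 / (1 - z) - 1"
  have KW: "K * (1 - z) = z" using W by (simp add: K_def field_simps)
  have "(\<Sum>y\<in>UNIV. e ((1 - y) / y) ^ 7 * e (1 + K * y)) = (\<Sum>y | 1 + K * y \<noteq> 0. e ((1 - y) / y) ^ 7 * e (1 + K * y))"
    by (rule sum.mono_neutral_right) (auto simp: e_simps)
  also have "\<dots> = (\<Sum>y | 1 - z * y \<noteq> 0. e ((1 - y) / ((1 - z) * y)) ^ 7 / e (1 - z * y))"
  \<comment> \<open>This Moebius map fixes 0 and 1 and satisfies
    \<open>1 - z * j y = 1 / (1 + K * y)\<close>, so it turns the factor \<open>e\<close> into the
    inverse factor that the period contains. Its pole and that of its inverse are left out of the
    two index sets.\<close>
  proof (rule sum.reindex_bij_witness[where j="\<lambda>y. y / (1 - z) / (1 + K * y)" and i="\<lambda>y. (1 - z) * y / (1 - z * y)"])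
    fix y assume y: "y \<in> {y. 1 + K * y \<noteq> 0}"
    then have y': "1 + K * y \<noteq> 0" by simp
    have "z * (y / (1 - z) / (1 + K * y)) = K * (1 - z) * (y / (1 - z) / (1 + K * y))"
      by (simp only: KW)
    also have "\<dots> = K * y / (1 + K * y)" using W by simp
    finally have "z * (y / (1 - z) / (1 + K * y)) = K * y / (1 + K * y)" .
    then have D: "1 - z * (y / (1 - z) / (1 + K * y)) = 1 / (1 + K * y)"
      using y' by (simp add: field_simps)
    show "(1 - z) * (y / (1 - z) / (1 + K * y)) / (1 - z * (y / (1 - z) / (1 + K * y))) = y"
      unfolding D using W y' by simp
    show "y / (1 - z) / (1 + K * y) \<in> {y. 1 - z * y \<noteq> 0}"
      unfolding mem_Collect_eq D using y' by simp
    have "1 - y / (1 - z) / (1 + K * y) = (1 - y) / (1 + K * y)"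
    proof -
      have "y / (1 - z) = (1 + K) * y" by (simp add: K_def)
      then have "1 - y / (1 - z) / (1 + K * y) = (1 + K * y - (1 + K) * y) / (1 + K * y)"
        using y' by (simp add: diff_divide_distrib)
      then show ?thesis by (simp add: algebra_simps)
    qed
    then have "(1 - y / (1 - z) / (1 + K * y)) / ((1 - z) * (y / (1 - z) / (1 + K * y))) = (1 - y) / y"
      using W y' by simp
    then show "e ((1 - y / (1 - z) / (1 + K * y)) / ((1 - z) * (y / (1 - z) / (1 + K * y)))) ^ 7 /
        e (1 - z * (y / (1 - z) / (1 + K * y))) = e ((1 - y) / y) ^ 7 * e (1 + K * y)"
      unfolding D by (simp add: e_simps)
  next
    fix y assume y: "y \<in> {y. 1 - z * y \<noteq> 0}"
    then have y': "1 - z * y \<noteq> 0" by simp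
    have "K * ((1 - z) * y / (1 - z * y)) = z * y / (1 - z * y)"
      using KW by (metis mult.assoc times_divide_eq_right)
    then have D: "1 + K * ((1 - z) * y / (1 - z * y)) = 1 / (1 - z * y)"
      using y' by (simp add: field_simps)
    show "(1 - z) * y / (1 - z * y) / (1 - z) / (1 + K * ((1 - z) * y / (1 - z * y))) = y"
      unfolding D using W y' by simp
    show "(1 - z) * y / (1 - z * y) \<in> {y. 1 + K * y \<noteq> 0}"
      unfolding mem_Collect_eq D using y' by simp
  qed
  also have "\<dots> = (\<Sum>y\<in>UNIV. e ((1 - y) / ((1 - z) * y)) ^ 7 / e (1 - z * y))"
    by (rule sum.mono_neutral_left) (auto simp: e_simps)
  finally have "e (1 - z) ^ 7 * (\<Sum>y\<in>UNIV. e ((1 - y) / y) ^ 7 * e (1 + K * y))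
      = (\<Sum>y\<in>UNIV. e (1 - z) ^ 7 * (e ((1 - y) / ((1 - z) * y)) ^ 7 / e (1 - z * y)))"
    by (simp add: sum_distrib_left)
  also have "\<dots> = period21 e (char_pow e 5) triv_char z"
    unfolding period21_def
  proof (rule sum.cong[OF refl])
    fix y
    show "e (1 - z) ^ 7 * (e ((1 - y) / ((1 - z) * y)) ^ 7 / e (1 - z * y))
      = char_pow e 5 y * (char_conj (char_pow e 5) (1 - y) * triv_char (1 - y)) * char_conj e (1 - z * y)"
    proof (cases "y = 0 \<or> y = 1")
      case False
      then have y: "y \<noteq> 0" "1 - y \<noteq> 0" by auto
      \<comment> \<open>Modulo 12 the exponent 7 is -5, which matches
        \<open>e ((1 - y) / y) ^ 7\<close> with the characters \<open>e ^ 5\<close> and its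
        conjugate in the period.\<close>
      have "e y ^ 12 = 1" "e (1 - y) ^ 12 = 1" using y e_pow12 by auto
      then have "e (1 - y) ^ 7 * e (1 - y) ^ 5 = e y ^ 5 * e y ^ 7" by (simp flip: power_add)
      then have "(e (1 - y) / e y) ^ 7 = e y ^ 5 * inverse (e (1 - y)) ^ 5"
        using e_nonzero[OF y(1)] e_nonzero[OF y(2)] by (simp add: power_divide field_simps)
      moreover have "e (1 - z) ^ 7 * (e ((1 - y) / ((1 - z) * y)) ^ 7 / e (1 - z * y))
         = (e (1 - y) / e y) ^ 7 / e (1 - z * y)"
        using e_nonzero[OF W] by (simp add: e_simps power_divide power_mult_distrib)
      ultimately show ?thesis
        using y by (simp add: char_pow_def char_conj_def triv_char_def cnj_e divide_inverse)
    qed (auto simp: e_simps char_pow_def char_conj_def triv_char_def)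
  qed
  finally show ?thesis by (simp add: K_def)
qed

text \<open>The cubic transformation for \<open>quad_char\<close> gives the argument
  \<open>1 + (y + k / y) / 3\<close>, which is \<open>(y * y + 3 * y + k) / (3 * y)\<close>.
  Completing the square by \<open>y = - h * (1 + r)\<close> produces
  \<open>r * r + (1 / W - 1)\<close>, with \<open>W\<close> fixed by
  \<open>k = h * h / W\<close>.\<close>

lemma elliptic_sum:
  fixes c W :: 'a
  assumes c: "c \<noteq> 0" and W: "W = - 27 * c / 4"
  shows "(\<Sum>u\<in>UNIV. quad_char (c * u ^ 3 + u + 1)) =
    quad_char (2::'a) * e W ^ 4 * (\<Sum>r\<in>UNIV. (e (1 + r) ^ 7) ^ 2 * quad_char (r * r + (1 / W - 1)))"
proof -
  define h :: 'a where "h = 3 / 2"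
  define k where "k = - 1 / (3 * c)"
  have two: "(2::'a) \<noteq> 0" and three: "(3::'a) \<noteq> 0"
    using two_nonzero cubic.three_nonzero by auto
  have four: "(4::'a) \<noteq> 0" and t7: "(27::'a) \<noteq> 0"
    by (rule four_nonzero twentyseven_nonzero)+
  have h0: "h \<noteq> 0" using two three by (simp add: h_def)
  have W0: "W \<noteq> 0" unfolding W using c four t7 by simp
  have k: "k = h * h / W"
  proof -
    have "4 * W = - 9 * (3 * c)" unfolding W using four by simp
    then have "k * (4 * W) = - 9 * (k * (3 * c))" by (simp only: mult_ac)
    also have "k * (3 * c) = - 1" using c three by (simp add: k_def)
    finally have "k * (4 * W) = 9" by simp
    moreover have "4 * (h * h) = 9" using four by (simp add: h_def)
    ultimately have "4 * (k * W) = 4 * (h * h)" by (simp add: mult_ac)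
    then have "k * W = h * h" using four by simp
    then show ?thesis using W0 by (simp add: field_simps)
  qed
  let ?t = "\<lambda>y. char_pow e 4 y * char_pow e 4 (k / y) ^ 2 * quad_char (1 + (y + k / y) / 3)"
  have "(\<Sum>u\<in>UNIV. quad_char (c * u ^ 3 + u + 1)) = (\<Sum>y\<in>UNIV. ?t y)"
    by (rule cubic.cubic_transformation[OF _ c k_def])
      (rule sum_mult_char_eq_0[OF mult_char_quad quad_nontriv])
  also have "\<dots> = (\<Sum>r\<in>UNIV. ?t (- h * r + - h))"
    by (rule sum_affine[symmetric]) (use h0 in simp)
  also have "\<dots> = (\<Sum>r\<in>UNIV. quad_char (2::'a) * e W ^ 4 * ((e (1 + r) ^ 7) ^ 2 * quad_char (r * r + (1 / W - 1))))"
  proof (rule sum.cong[OF refl])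
    fix r
    show "?t (- h * r + - h) = quad_char (2::'a) * e W ^ 4 * ((e (1 + r) ^ 7) ^ 2 * quad_char (r * r + (1 / W - 1)))"
    proof (cases "1 + r = 0")
      case True
      have "- h * r + - h = - h * (1 + r)" by (simp add: algebra_simps)
      then show ?thesis using True by (simp add: char_pow_def e_simps)
    next
      case r: False
      have y: "- h * r + - h = - 1 * h * (1 + r)" by (simp add: algebra_simps)
      have ky: "k / (- 1 * h * (1 + r)) = - 1 * h / (W * (1 + r))"
        unfolding k using h0 W0 r by (simp add: divide_simps)
      \<comment> \<open>The denominator is made a perfect square, so that \<open>quad_char\<close>
        sees only the numerator.\<close>
      have arg: "1 + (- 1 * h * (1 + r) + - 1 * h / (W * (1 + r))) / 3
          = - 1 * (r * r + (1 / W - 1)) * 2 * (1 + r) / ((2 * (1 + r)) * (2 * (1 + r)))"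
      proof -
        define A i where "A = 1 + r" and "i = 1 / (2::'a)"
        have A0: "A \<noteq> 0" using r by (simp add: A_def)
        have i: "2 * i = 1" and hi: "h = 3 * i" using two by (simp_all add: i_def h_def)
        have "- 1 * h / (W * A) = 3 * (- i * (1 / W) * (1 / A))" by (simp add: hi)
        then have L: "(- 1 * h * A + - 1 * h / (W * A)) / 3 = - i * A - i * (1 / W) * (1 / A)"
          using three by (simp add: hi)
        have "x * d * A / ((d * A) * (d * A)) = x * (1 / d) * (1 / A)" if "d \<noteq> 0" for x d
          using that A0 by simp
        note R = this[OF two, folded i_def]
        have M: "1 + (- i * A - i * v * u) = - 1 * (r * r + (v - 1)) * i * u" if "A * u = 1" for u v
          using that i A_def by Groebner_Basis.algebra
        show ?thesis unfolding A_def[symmetric] L R by (rule M) (use A0 in simp)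
      qed
      have "e h ^ 12 = 1" "e (1 + r) ^ 12 = 1" "e W ^ 12 = 1"
        "e (- 1) ^ 12 = 1"
        using e_pow12 h0 r W0 two by auto
      note p = this
      have "quad_char (1 + (- 1 * h * (1 + r) + - 1 * h / (W * (1 + r))) / 3)
          = quad_char (r * r + (1 / W - 1)) * quad_char (2::'a) * e (1 + r) ^ 6"
      proof -
        have "quad_char ((2 * (1 + r)) * (2 * (1 + r))) = 1"
          using quad_char_square[of "2 * (1 + r)"] two r by (metis mult_eq_0_iff)
        then show ?thesis
          unfolding arg mult_char_divide[OF mult_char_quad] mult_char_mult[OF mult_char_quad] quad_char_minus_1
          by (simp add: quad_char_e)
      qed
      moreover have "char_pow e 4 (- 1 * h * (1 + r)) * char_pow e 4 (- 1 * h / (W * (1 + r))) ^ 2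
          = e W ^ 4 * e (1 + r) ^ 8"
      proof -
        have n: "e W \<noteq> 0" "e (1 + r) \<noteq> 0" using e_nonzero W0 r by auto
        have "char_pow e 4 (- 1 * h * (1 + r)) * char_pow e 4 (- 1 * h / (W * (1 + r))) ^ 2
           = (e (- 1) * e h * e (1 + r)) ^ 4 * (e (- 1) * e h / (e W * e (1 + r))) ^ 8"
          unfolding char_pow_def e_simps by (simp flip: power_mult)
        also have "\<dots> = e (- 1) ^ 12 * e h ^ 12 * (e (1 + r) ^ 4 / (e W ^ 8 * e (1 + r) ^ 8))"
          by (simp add: power_mult_distrib power_divide mult_ac flip: power_add)
        \<comment> \<open>All these twelfth powers are 1; the exchange turns the exponents -8 of
          \<open>e W\<close> and -4 of \<open>e (1 + r)\<close> into 4 and 8.\<close>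
        also have "\<dots> = e W ^ 12 * e (1 + r) ^ 12 * (e (1 + r) ^ 4 / (e W ^ 8 * e (1 + r) ^ 8))"
          by (simp only: p)
        also have "\<dots> = e W ^ 4 * e (1 + r) ^ 8"
          using n by (simp add: field_simps flip: power_add)
        finally show ?thesis .
      qed
      \<comment> \<open>The exponent 14 is kept instead of 2 because
        \<open>quadratic_transformation\<close> is applied with \<open>m\<close> the seventh power
        of \<open>e\<close>.\<close>
      moreover have "(e (1 + r) ^ 7) ^ 2 = e (1 + r) ^ 8 * e (1 + r) ^ 6"
        by (simp flip: power_add power_mult)
      ultimately show ?thesis unfolding y ky by (simp only: mult_ac)
    qed
  qed
  finally show ?thesis by (simp add: sum_distrib_left)
qed

text \<open>The Legendre cubic is depressed to \<open>x ^ 3 + a * x + b\<close> and rescaled to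
  \<open>b * (c * u ^ 3 + u + 1)\<close>. Then \<open>elliptic_sum\<close>,
  \<open>quadratic_transformation\<close> and \<open>period_reflection\<close> express both periods
  by the same sum \<open>?T\<close>, and only the character factors remain to be compared.\<close>

theorem period_transformation:
  assumes lam: "lam \<notin> {- 1, 2, 1 / 2}" and N0: "lam\<^sup>2 - lam + 1 \<noteq> 0"
  shows "period21 e (char_pow e 5) triv_char
           (27 * lam\<^sup>2 * (lam - 1)\<^sup>2 / (4 * (lam\<^sup>2 - lam + 1) ^ 3))
       = e (- 1) * char_pow e 3 (1 - lam + lam\<^sup>2) * period21 quad_char quad_char triv_char lam"
proof -
  have two: "(2::'a) \<noteq> 0" and three: "(3::'a) \<noteq> 0"
    using two_nonzero cubic.three_nonzero by auto
  have t7: "(27::'a) = 3 ^ 3" by simp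
  have n27: "(27::'a) \<noteq> 0" and n4: "(4::'a) \<noteq> 0"
    by (rule four_nonzero twentyseven_nonzero)+
  define N where "N = lam\<^sup>2 - lam + 1"
  \<comment> \<open>Up to the factor -1/27 this is the constant term of the depressed cubic; the
    excluded values of \<open>lam\<close> are its zeros.\<close>
  define B where "B = (lam + 1) * (lam - 2) * (2 * lam - 1)"
  define a b c z W where "a = - N / 3" and "b = - B / 27" and "c = b\<^sup>2 / a ^ 3"
    and "z = 27 * lam\<^sup>2 * (lam - 1)\<^sup>2 / (4 * N ^ 3)" and "W = 1 - z"
  have N: "N \<noteq> 0" using N0 by (simp add: N_def)
  have "lam + 1 \<noteq> 0" "lam - 2 \<noteq> 0" "2 * lam - 1 \<noteq> 0"
    using lam two by (auto simp: eq_neg_iff_add_eq_0 field_simps)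
  then have B0: "B \<noteq> 0" by (simp add: B_def)
  have a0: "a \<noteq> 0" and b0: "b \<noteq> 0" using N B0 n27 three by (simp_all add: a_def b_def)
  have c0: "c \<noteq> 0" using a0 b0 by (simp add: c_def)
  have W: "W = (B / 2)\<^sup>2 / N ^ 3"
  proof -
    have d0: "4 * N ^ 3 \<noteq> 0" using N n4 by simp
    \<comment> \<open>This is 27 times the discriminant identity \<open>- 4 * a ^ 3 - 27 * b\<^sup>2
      = lam\<^sup>2 * (lam - 1)\<^sup>2\<close>, rearranged.\<close>
    have "4 * N ^ 3 - 27 * lam\<^sup>2 * (lam - 1)\<^sup>2 = B\<^sup>2"
      unfolding N_def B_def by Groebner_Basis.algebra
    then have "W = B\<^sup>2 / (4 * N ^ 3)"
      unfolding W_def z_def by (metis d0 diff_divide_distrib divide_self)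
    then show ?thesis by (simp add: power_divide)
  qed
  then have W0: "W \<noteq> 0" using N B0 two by simp
  have Wc: "W = - 27 * c / 4"
  proof -
    define t :: 'a where "t = 27"
    have t0: "t \<noteq> 0" using n27 by (simp add: t_def)
    have "B = - (t * b)" using n27 by (simp add: b_def t_def)
    moreover have "N = - 3 * a" using three by (simp add: a_def)
    then have "N ^ 3 = - (t * a ^ 3)" by (simp add: t_def power_mult_distrib)
    ultimately have "W = - t * c / 4"
      unfolding W c_def using t0 a0 by (simp add: power_divide power2_eq_square mult_ac)
    then show ?thesis by (simp add: t_def)
  qed
  let ?T = "\<Sum>r\<in>UNIV. (e (1 + r) ^ 7) ^ 2 * quad_char (r * r + (1 / W - 1))"
  let ?S = "\<Sum>u\<in>UNIV. quad_char (c * u ^ 3 + u + 1)"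
  let ?P = "period21 quad_char quad_char triv_char lam"
  have P: "?P = quad_char b * ?S"
  proof -
    have "?P = (\<Sum>x\<in>UNIV. quad_char (x * (x - 1) * (x - lam)))"
      by (rule period_quad_char[OF mult_char_quad])
    \<comment> \<open>The shift to the mean of the roots removes the quadratic term; the scale
      \<open>b / a\<close> makes the linear and constant coefficients both \<open>b\<close>.\<close>
    also have "\<dots> = (\<Sum>u\<in>UNIV. quad_char ((b / a * u + (1 + lam) / 3) * ((b / a * u + (1 + lam) / 3) - 1)
        * ((b / a * u + (1 + lam) / 3) - lam)))"
      by (rule sum_affine[symmetric]) (use a0 b0 in simp)
    also have "\<dots> = (\<Sum>u\<in>UNIV. quad_char (b * (c * u ^ 3 + u + 1)))"
    proof (intro sum.cong arg_cong[where f=quad_char] refl)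
      fix u
      define X where "X = b / a * u"
      have "(X + (1 + lam) / 3) * ((X + (1 + lam) / 3) - 1) * ((X + (1 + lam) / 3) - lam) = X ^ 3 + a * X + b"
      proof -
        define l3 where "l3 = (1 + lam) / 3"
        have "3 * l3 = 1 + lam" using three by (simp add: l3_def del: distrib_left_numeral)
        then have l: "lam = 3 * l3 - 1" by simp
        have "N = 3 * (3 * l3\<^sup>2 - 3 * l3 + 1)"
          unfolding N_def l by (simp add: algebra_simps power2_eq_square)
        then have a': "a = - (3 * l3\<^sup>2 - 3 * l3 + 1)"
          using three by (simp add: a_def del: distrib_left_numeral right_diff_distrib_numeral)
        have "B = 27 * (l3 * (l3 - 1) * (2 * l3 - 1))"
          unfolding B_def l by (simp add: algebra_simps)
        then have b': "b = - (l3 * (l3 - 1) * (2 * l3 - 1))"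
          using n27 by (simp add: b_def)
        show ?thesis unfolding l3_def[symmetric] a' b' l
          using three by (simp add: algebra_simps power2_eq_square power3_eq_cube)
      qed
      also have "X ^ 3 + a * X + b = b * (c * u ^ 3 + u + 1)"
        unfolding X_def c_def using a0 by (simp add: field_simps eval_nat_numeral)
      finally show "(b / a * u + (1 + lam) / 3) * ((b / a * u + (1 + lam) / 3) - 1)
        * ((b / a * u + (1 + lam) / 3) - lam) = b * (c * u ^ 3 + u + 1)"
        unfolding X_def .
    qed
    also have "\<dots> = quad_char b * ?S"
      by (simp add: mult_char_mult[OF mult_char_quad] sum_distrib_left)
    finally show ?thesis .
  qed
  have S: "?S = quad_char (2::'a) * e W ^ 4 * ?T" by (rule elliptic_sum[OF c0 Wc])
  \<comment> \<open>The exponents add to 13, so the product character in the transformed sum is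
    \<open>e\<close> itself.\<close>
  have e13: "quad_char x * char_pow e 7 x = e x" for x
    using e_pow12[of x] by (cases "x = 0")
      (simp_all add: quad_char_e char_pow_def e_simps eval_nat_numeral mult.assoc)
  have "?T = e (- 1) ^ 7 * (\<Sum>y\<in>UNIV. e ((1 - y) / y) ^ 7 * e (1 + (1 / W - 1) * y))"
  proof -
    have "e \<noteq> triv_char" using char_pow_nontriv[of 1] by (auto simp: char_pow_def fun_eq_iff)
    then have "(\<lambda>x. quad_char x * char_pow e 7 x) \<noteq> triv_char" unfolding e13 by simp
    then show ?thesis
      using quadratic_transformation[OF two mult_char_quad mult_char_char_pow[OF mult_char_e, of 7]
          char_pow_nontriv[of 7] quad_nontriv, of "1 / W - 1"]
      by (simp only: e13) (simp add: char_pow_def)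
  qed
  moreover have "period21 e (char_pow e 5) triv_char z = e W ^ 7 *
    (\<Sum>y\<in>UNIV. e ((1 - y) / y) ^ 7 * e (1 + (1 / W - 1) * y))"
    unfolding W_def by (rule period_reflection) (use W0 W_def in simp)
  moreover have em: "e (- 1) * e (- 1) = 1" using e_minus_1 by (simp add: power2_eq_square)
  moreover have "e (- 1) ^ 7 = e (- 1)" by (simp add: eval_nat_numeral em)
  ultimately have L: "period21 e (char_pow e 5) triv_char z = e (- 1) * e W ^ 7 * ?T"
    by simp
  \<comment> \<open>As \<open>W\<close> is \<open>(B / 2)\<^sup>2 / N ^ 3\<close>, the cube of
    \<open>e W\<close> is the quadratic character of \<open>B / 2\<close> times \<open>e N\<close>
    to the power -9, that is 3 modulo 12. The quadratic values cancel against those in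
    \<open>P\<close> and \<open>S\<close>.\<close>
  have "e W ^ 3 = quad_char B * quad_char (2::'a) * e N ^ 3"
  proof -
    have "e N ^ 12 = 1" using e_pow12[OF N] .
    then have "1 / (e N ^ 3) ^ 3 = e N ^ 3" using e_nonzero[OF N]
      by (simp add: field_simps flip: power_mult power_add)
    moreover have "(e B / e 2) ^ 6 = quad_char B * quad_char (2::'a)"
    proof -
      have "1 / quad_char (2::'a) = quad_char (2::'a)"
        using two by (simp add: quad_char_def)
      then show ?thesis by (simp add: quad_char_e divide_inverse power_mult_distrib power_inverse)
    qed
    moreover have "e W ^ 3 = (e B / e 2) ^ 6 * (1 / (e N ^ 3) ^ 3)"
      unfolding W e_simps by (simp only: power_divide flip: power_mult) simp
    ultimately show ?thesis by (simp only:)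
  qed
  moreover have "quad_char b = quad_char B"
  proof -
    have "b * 27 = - 1 * B" unfolding b_def using n27 by simp
    then have "quad_char b * quad_char (27::'a) = quad_char (- 1 :: 'a) * quad_char B"
      using mult_char_mult[OF mult_char_quad] by metis
    moreover have "quad_char (27::'a) = 1"
      by (simp only: t7 mult_char_power[OF mult_char_quad] quad_char_3 power_one)
    ultimately show ?thesis by (simp add: quad_char_minus_1)
  qed
  moreover have "e W ^ 7 = e W ^ 3 * e W ^ 4" by (simp flip: power_add)
  ultimately have "period21 e (char_pow e 5) triv_char z = e (- 1) * e N ^ 3 * ?P"
    unfolding L P S by (simp only: mult_ac)
  moreover have "1 - lam + lam\<^sup>2 = N" by (simp add: N_def)
  ultimately show ?thesis
    unfolding char_pow_def N_def[symmetric] z_def[symmetric] by simp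
qed

end

theorem mainTheorem18:
  fixes \<eta> :: "'p::prime_card mod_ring \<Rightarrow> complex" and lam :: "'p mod_ring"
  assumes "CARD('p) mod 12 = 1"
    and "primitive_char_of_order 12 \<eta>"
    and "lam \<notin> {-1, 2, 1/2}"
    and "lam\<^sup>2 - lam + 1 \<noteq> 0"
  shows "period21 \<eta> (char_pow \<eta> 5) triv_char
           (27 * lam\<^sup>2 * (lam - 1)\<^sup>2 / (4 * (lam\<^sup>2 - lam + 1) ^ 3))
       = \<eta> (-1) * char_pow \<eta> 3 (1 - lam + lam\<^sup>2) * period21 quad_char quad_char triv_char lam"
proof -
  interpret order12_character \<eta>
    by unfold_locales (fact assms(2))
  show ?thesis
    by (rule period_transformation[OF assms(3,4)])
qed

end
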